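(* For integers $n,k\ge 0$ let $b(n,k)$ be the number of $k$-dimensional faces of $\mathrm{I}(\mathfrak{sl}_n,V\oplus\bigwedge^2)$, and let $B(x,y)=\sum_{n\ge0}\sum_{k\ge0}b(n,k)x^ny^k$. Then $$B(x,y)=-\frac{4}{y\left(1-2x+x^2-2xy+x^2y+\sqrt{\alpha}\right)}+\frac{2-2x-2x^2+2x^3+y-3xy-3x^2y+3x^3y-2xy^2-x^2y^2+x^3y^2}{y\,(1-2x+2x^3-x^4-2xy+4x^3y-2x^4y+2x^3y^2-x^4y^2)}$$ in the fraction field of $R=\mathbb{Q}[[x,y]]$, where $$\alpha=1-2x^2+x^4-6x^2y+2x^4y-4x^2y^2+x^4y^2 .$$
   Context: $R=\mathbb{Q}[[x,y]]$; for $f\in R$ with $f(0,0)=1$, $\sqrt f$ denotes the unique square root of $f$ in $R$ with constant term $1$. Let $\mathfrak h=\mathbb{R}^n$ (real diagonal $n\times n$ matrices) with coordinate functions $x_1,\dots,x_n$, let $\mathfrak h_s=\{x_1+\cdots+x_n=0\}\subset\mathfrak h$, $W=\{x_1\ge x_2\ge\cdots\ge x_n\}$ and $W_s=W\cap\mathfrak h_s$. The incidence geometry $\mathrm{I}(\mathfrak{sl}_n,V\oplus\bigwedge^2)$ is the arrangement in $\mathfrak h_s$ of the kernels of the weights $x_i$ ($1\le i\le n$) and $x_i+x_j$ ($1\le i<j\le n$) (restricted to $\mathfrak h_s$), considered only inside the closed Weyl chamber $W_s$. A chamber is the closure of a connected component of the set of points in the interior of $W_s$ (relative to $\mathfrak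 h_s$) at which none of those weights that are not identically zero on $\mathfrak h_s$ vanishes. A face is a face, in the sense of convex polyhedral cones, of a chamber (chambers themselves and $\{0\}$ are faces, and faces contained in the walls $x_i=x_{i+1}$ of the Weyl chamber are counted). The dimension of a face is the dimension of its linear span. For $n=0$ (and $n=1$) the space $\mathfrak h_s$ is $\{0\}$ and there is exactly one face, of dimension $0$. *)

theory Defs
  imports
    "HOL-Analysis.Analysis"
    "HOL-Library.Function_Algebras"
    "HOL-Computational_Algebra.Formal_Power_Series"
    "HOL-Computational_Algebra.Fraction_Field"
begin

text \<open>
  The dimension n varies inside one generating function, so \<open>\<real>\<^sup>n\<close> cannot be a type. As in
  \<^const>\<open>Euclidean_space\<close> it is the set of functions \<^typ>\<open>nat \<Rightarrow> real\<close> that vanish from index n on.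
  The library has the product topology on this type but no \<^class>\<open>real_vector\<close> instance, which
  \<^const>\<open>face_of\<close> and \<^const>\<open>dim\<close> require.
\<close>

instantiation "fun" :: (type, real_vector) real_vector
begin

definition scaleR_fun_def: "scaleR c f = (\<lambda>x. scaleR c (f x))"

instance
  by standard
    (simp_all add: scaleR_fun_def fun_eq_iff scaleR_add_right scaleR_add_left)

end

lemma scaleR_fun_apply [simp]: "scaleR c f x = scaleR c (f x)"
  by (simp add: scaleR_fun_def)

text \<open>The coordinates \<open>x\<^sub>1, \<dots>, x\<^sub>n\<close> are indexed here by \<open>0, \<dots>, n - 1\<close>.\<close>

definition cartan_sl :: "nat \<Rightarrow> (nat \<Rightarrow> real) set" where
  "cartan_sl n = {x \<in> topspace (Euclidean_space n). (\<Sum>i<n. x i) = 0}"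

definition weyl_chamber_sl :: "nat \<Rightarrow> (nat \<Rightarrow> real) set" where
  "weyl_chamber_sl n = {x \<in> cartan_sl n. \<forall>i. Suc i < n \<longrightarrow> x i \<ge> x (Suc i)}"

definition weights :: "nat \<Rightarrow> ((nat \<Rightarrow> real) \<Rightarrow> real) set" where
  "weights n = {(\<lambda>x. x i) | i. i < n} \<union> {(\<lambda>x. x i + x j) | i j. i < j \<and> j < n}"

text \<open>
  On \<^term>\<open>cartan_sl n\<close> the weight \<open>x\<^sub>1\<close> is identically zero for \<open>n = 1\<close>, and so is \<open>x\<^sub>1 + x\<^sub>2\<close>
  for \<open>n = 2\<close>.
\<close>

definition nonzero_weights :: "nat \<Rightarrow> ((nat \<Rightarrow> real) \<Rightarrow> real) set" where
  "nonzero_weights n = {w \<in> weights n. \<exists>x \<in> cartan_sl n. w x \<noteq> 0}"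

definition regular_points :: "nat \<Rightarrow> (nat \<Rightarrow> real) set" where
  "regular_points n =
     {x \<in> top_of_set (cartan_sl n) interior_of weyl_chamber_sl n.
        \<forall>w \<in> nonzero_weights n. w x \<noteq> 0}"

definition chambers :: "nat \<Rightarrow> (nat \<Rightarrow> real) set set" where
  "chambers n = closure ` components (regular_points n)"

text \<open>
  The relation \<^const>\<open>face_of\<close> also admits the empty set, which is not a face of a polyhedral cone.
\<close>

definition faces :: "nat \<Rightarrow> (nat \<Rightarrow> real) set set" where
  "faces n = {F. F \<noteq> {} \<and> (\<exists>C \<in> chambers n. F face_of C)}"

definition num_faces :: "nat \<Rightarrow> nat \<Rightarrow> nat" where
  "num_faces n k = card {F \<in> faces n. dim (span F) = k}"

text \<open>
  \<open>\<rat>[[x,y]]\<close> is \<open>\<rat>[[y]][[x]]\<close>: the coefficient of \<open>x\<^sup>n y\<^sup>k\<close> in f is \<open>fps_nth (fps_nth f n) k\<close>.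
\<close>

type_synonym series2 = "rat fps fps"

definition X :: series2 where "X = fps_X"

definition Y :: series2 where "Y = fps_const fps_X"

definition sqrt_series :: "series2 \<Rightarrow> series2" where
  "sqrt_series f = (THE g. g\<^sup>2 = f \<and> fps_nth (fps_nth g 0) 0 = 1)"

definition face_series :: series2 where
  "face_series = Abs_fps (\<lambda>n. Abs_fps (\<lambda>k. of_nat (num_faces n k)))"

definition alpha :: series2 where
  "alpha = 1 - 2*X^2 + X^4 - 6*X^2*Y + 2*X^4*Y - 4*X^2*Y^2 + X^4*Y^2"

definition to_frac :: "series2 \<Rightarrow> series2 fract" where
  "to_frac f = Fraction_Field.Fract f 1"

end

theory Submission
  imports Defs
begin

text \<open>
  Inside the Weyl chamber the weights compare absolute values of coordinates only. A point \<open>z\<close> therefore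
  lies in the cell that is described by a word: if \<open>v\<^sub>1 > \<dots> > v\<^sub>m > 0\<close> are the positive absolute values
  of its coordinates, the \<open>i\<close>-th letter is the pair \<open>(p\<^sub>i, q\<^sub>i)\<close> of the numbers of coordinates equal
  to \<open>v\<^sub>i\<close> and to \<open>- v\<^sub>i\<close>. The faces of the chambers are the closures of the cells
  (\<open>chamber_arrangement.faces_eq\<close>), and two points span the same face exactly if their words agree
  (\<open>closed_cell_eq_iff_word\<close>).

  A word of total size at most \<open>n\<close> occurs on the space of trace zero if and only if
  \<open>\<Sum> (p\<^sub>i - q\<^sub>i) v\<^sub>i = 0\<close> has a solution with \<open>v\<^sub>1 > \<dots> > v\<^sub>m > 0\<close>. By Abel summation the left hand side is
  a combination of the heights \<open>h\<^sub>j = \<Sum>\<^sub>i\<^sub>\<le>\<^sub>j (p\<^sub>i - q\<^sub>i)\<close> whose coefficients are the gaps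
  \<open>v\<^sub>j - v\<^sub>j\<^sub>+\<^sub>1\<close>, and these are arbitrary positive numbers. So the condition is that the heights vanish
  identically or take both signs (\<open>words_of_chamber\<close>). The trace is a trivial condition on the cell in the
  first case and cuts the dimension from \<open>m\<close> to \<open>m - 1\<close> in the second (\<open>dim_closed_cell\<close>). If \<open>T\<close>, \<open>P\<close>
  and \<open>Z\<close> enumerate the words without restriction, with nonnegative heights, and with zero heights, with
  \<open>x\<close> marking a bound on the size and \<open>y\<close> the length, then inclusion and exclusion give
  \<open>y B = (T - 2 P + Z) + y Z\<close> (\<open>face_series_eq\<close>).

  Removing one unit from the first letter yields linear recurrences (\<open>card_walks_heading\<close>). They make \<open>T\<close>
  and \<open>Z\<close> rational. For \<open>P\<close> let \<open>P\<^sub>h\<close> be the series of the words that are nonnegative when started at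
  height \<open>h\<close>. The defects \<open>D\<^sub>h = T - P\<^sub>h\<close> satisfy a palindromic linear recurrence of order two, hence
  \<open>D\<^sub>h\<^sub>+\<^sub>2 D\<^sub>h - D\<^sub>h\<^sub>+\<^sub>1\<^sup>2\<close> does not depend on \<open>h\<close>; since \<open>x\<^sup>h\<^sup>+\<^sup>1\<close> divides \<open>D\<^sub>h\<close>, it is zero
  (\<open>defect_geometric\<close>). Together with the boundary relation at height \<open>0\<close> this is a quadratic equation for
  \<open>P = P\<^sub>0\<close>, and its discriminant is \<open>\<alpha>\<close> (\<open>walks_above_sqrt\<close>).
\<close>

section \<open>Arrangements of hyperplanes inside a chamber\<close>

lemma continuous_on_line: "continuous_on S (\<lambda>t. x + t *\<^sub>R u)" for x u :: "'i \<Rightarrow> real"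
  by (rule continuous_on_coordinatewise_then_product)
     (auto intro!: continuous_intros simp: plus_fun_def)

lemma tendsto_line: "((\<lambda>t. x + t *\<^sub>R u) \<longlongrightarrow> x) (at_right 0)" for x u :: "'i \<Rightarrow> real"
proof -
  have "isCont (\<lambda>t. x + t *\<^sub>R u) 0"
    using continuous_on_line[of UNIV x u] by (simp add: continuous_on_eq_continuous_at)
  then have "((\<lambda>t. x + t *\<^sub>R u) \<longlongrightarrow> x) (at 0)" by (simp add: isCont_def)
  then show ?thesis by (rule tendsto_mono[OF at_le[OF subset_UNIV]])
qed

text \<open>
  Moving a short way from \<open>x\<close> in direction \<open>u\<close> keeps the nonzero signs of finitely many linear
  forms and replaces the zero ones by their signs at \<open>u\<close>. All the geometry of cells below rests on this.
\<close>

lemma eventually_sgn_line: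
  assumes "finite L" "\<And>f. f \<in> L \<Longrightarrow> linear f"
  shows "\<forall>\<^sub>F t in at_right 0. t > 0 \<and>
    (\<forall>f\<in>L. sgn (f (x + t *\<^sub>R u)) = (if f x = 0 then sgn (f u) else sgn (f x :: real)))"
proof (intro eventually_conj eventually_ball_finite ballI assms(1))
  show pos: "\<forall>\<^sub>F t in at_right (0::real). t > 0" by (rule eventually_at_right_less)
  fix f assume "f \<in> L"
  then have lin: "f (x + t *\<^sub>R u) = f x + t * f u" for t
    using assms(2) by (simp add: linear_add linear_scale)
  have "((\<lambda>t. f x + t * f u) \<longlongrightarrow> f x + 0 * f u) (at_right 0)"
    by (intro tendsto_intros)
  then have lim: "((\<lambda>t. f (x + t *\<^sub>R u)) \<longlongrightarrow> f x) (at_right 0)" by (simp add: lin)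
  consider "f x = 0" | "f x > 0" | "f x < 0" by linarith
  then show "\<forall>\<^sub>F t in at_right 0. sgn (f (x + t *\<^sub>R u)) = (if f x = 0 then sgn (f u) else sgn (f x))"
  proof cases
    case 1
    show ?thesis using pos by eventually_elim (simp add: lin 1 sgn_mult)
  next
    case 2
    show ?thesis using order_tendstoD(1)[OF lim 2] by eventually_elim (use 2 in simp)
  next
    case 3
    show ?thesis using order_tendstoD(2)[OF lim 3] by eventually_elim (use 3 in simp)
  qed
qed

text \<open>
  The left hand side is closed under limits and convex combinations, the right hand side is what
  one wants to know about cells.
\<close>

lemma weak_sign_iff:
  "(0 \<le> a \<longrightarrow> 0 \<le> b) \<and> (a \<le> 0 \<longrightarrow> b \<le> 0) \<longleftrightarrow> b = 0 \<or> sgn b = sgn a" for a b :: real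
  by (auto simp: sgn_if)

text \<open>
  The forms in \<open>P\<close> bound a chamber of the space \<open>V\<close>, and the forms in \<open>N\<close> cut it into pieces. Both kinds
  are treated alike in the definition of cells, since faces in the walls of the chamber count as well.
\<close>

locale chamber_arrangement =
  fixes V :: "('i \<Rightarrow> real) set" and P N :: "(('i \<Rightarrow> real) \<Rightarrow> real) set"
  assumes subspace_V: "subspace V" and closed_V: "closed V"
    and finite_PN: "finite (P \<union> N)"
    and linear_PN: "f \<in> P \<union> N \<Longrightarrow> linear f"
    and continuous_PN: "f \<in> P \<union> N \<Longrightarrow> continuous_on UNIV f"
    and nonzero_N: "f \<in> N \<Longrightarrow> \<exists>u\<in>V. f u \<noteq> 0"
    and interior_point: "\<exists>b\<in>V. \<forall>f\<in>P. f b > 0"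

begin

definition dominant :: "('i \<Rightarrow> real) set" where
  "dominant = {x \<in> V. \<forall>f\<in>P. 0 \<le> f x}"

definition regular :: "('i \<Rightarrow> real) set" where
  "regular = {x \<in> top_of_set V interior_of dominant. \<forall>f\<in>N. f x \<noteq> 0}"

text \<open>
  The closure of the cell of \<open>z\<close>, which is the set of points of \<open>V\<close> with the signs of \<open>z\<close>. A form that
  vanishes at \<open>z\<close> satisfies both premises and thus vanishes on the whole set.
\<close>

definition closed_cell :: "('i \<Rightarrow> real) \<Rightarrow> ('i \<Rightarrow> real) set" where
  "closed_cell z = {y \<in> V. \<forall>f\<in>P \<union> N. (0 \<le> f z \<longrightarrow> 0 \<le> f y) \<and> (f z \<le> 0 \<longrightarrow> f y \<le> 0)}"

definition open_cell :: "('i \<Rightarrow> real) \<Rightarrow> ('i \<Rightarrow> real) set" where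
  "open_cell z = {y \<in> V. \<forall>f\<in>P \<union> N. sgn (f y) = sgn (f z)}"

lemma closed_cellD:
  "y \<in> closed_cell z \<Longrightarrow> f \<in> P \<union> N \<Longrightarrow> (0 \<le> f z \<longrightarrow> 0 \<le> f y) \<and> (f z \<le> 0 \<longrightarrow> f y \<le> 0)"
  unfolding closed_cell_def by blast

lemma line_in_V: "x \<in> V \<Longrightarrow> u \<in> V \<Longrightarrow> x + t *\<^sub>R u \<in> V"
  using subspace_V by (simp add: subspace_add subspace_scale)

lemma PN_line: "f \<in> P \<union> N \<Longrightarrow> f (x + t *\<^sub>R u) = f x + t * f u"
  using linear_PN by (simp add: linear_add linear_scale)

lemma eventually_sgn_PN:
  "\<forall>\<^sub>F t in at_right 0. t > 0 \<and>
    (\<forall>f\<in>P \<union> N. sgn (f (x + t *\<^sub>R u)) = (if f x = 0 then sgn (f u) else sgn (f x)))"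
  by (rule eventually_sgn_line[OF finite_PN linear_PN])

lemma obtain_small:
  assumes "\<forall>\<^sub>F t in at_right (0::real). Q t"
  obtains t where "t > 0" "Q t"
    "\<And>f. f \<in> P \<union> N \<Longrightarrow> sgn (f (x + t *\<^sub>R u)) = (if f x = 0 then sgn (f u) else sgn (f x))"
  using eventually_happens'[OF trivial_limit_at_right_real
      eventually_conj[OF assms eventually_sgn_PN[of x u]]]
  by blast

text \<open>
  A form in \<open>P\<close> is positive at some \<open>b\<close>, so from a point where it vanishes one leaves the chamber in the
  direction of \<open>- b\<close>.
\<close>

lemma regular_eq: "regular = {x \<in> V. (\<forall>f\<in>P. 0 < f x) \<and> (\<forall>f\<in>N. f x \<noteq> 0)}"
proof -
  have "top_of_set V interior_of dominant = {x \<in> V. \<forall>f\<in>P. 0 < f x}" (is "?I = ?S")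
  proof
    show "?I \<subseteq> ?S"
    proof
      fix x assume "x \<in> ?I"
      then obtain T where T: "openin (top_of_set V) T" "x \<in> T" "T \<subseteq> dominant"
        unfolding interior_of_def by auto
      then obtain S where S: "open S" "T = V \<inter> S" by (auto simp: openin_open)
      obtain b where b: "b \<in> V" "\<And>f. f \<in> P \<Longrightarrow> f b > 0" using interior_point by blast
      have x: "x \<in> V" "\<And>f. f \<in> P \<Longrightarrow> 0 \<le> f x" using T by (auto simp: dominant_def)
      have "f x \<noteq> 0" if f: "f \<in> P" for f
      proof
        assume "f x = 0"
        have "\<forall>\<^sub>F t in at_right 0. x + t *\<^sub>R (- b) \<in> S"
          using T S by (intro topological_tendstoD[OF tendsto_line]) auto
        then obtain t where t: "t > 0" "x + t *\<^sub>R (- b) \<in> S" using obtain_small by metis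
        then have "x + t *\<^sub>R (- b) \<in> dominant"
          using T S x(1) b(1) subspace_V by (blast intro: line_in_V subspace_neg)
        then have "0 \<le> f (x + t *\<^sub>R (- b))" using f by (simp add: dominant_def)
        moreover have "f (- b) = - f b" using f linear_PN by (simp add: linear_neg)
        ultimately show False
          using PN_line[of f x t "- b"] \<open>f x = 0\<close> f t(1) b(2)[OF f] by (simp add: mult_le_0_iff)
      qed
      then show "x \<in> ?S" using x by (auto simp: less_le)
    qed
    have "open {x. 0 < f x}" if "f \<in> P" for f
      using that continuous_PN by (intro open_Collect_less) auto
    then have "open (\<Inter>f\<in>P. {x. 0 < f x})" using finite_PN by (intro open_INT) auto
    then have "openin (top_of_set V) (V \<inter> (\<Inter>f\<in>P. {x. 0 < f x}))" by (rule openin_open_Int)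
    moreover have "V \<inter> (\<Inter>f\<in>P. {x. 0 < f x}) = ?S" by auto
    moreover have "?S \<subseteq> dominant" by (auto simp: dominant_def less_imp_le)
    ultimately show "?S \<subseteq> ?I" by (simp add: interior_of_maximal)
  qed
  then show ?thesis by (auto simp: regular_def)
qed

lemma regular_nonzero: "x \<in> regular \<Longrightarrow> f \<in> P \<union> N \<Longrightarrow> f x \<noteq> 0"
  by (auto simp: regular_eq)

text \<open>
  The forms have no zero on the regular points, so by the intermediate value theorem their signs are constant
  on a connected set; conversely cells are convex.
\<close>

lemma regular_component:
  assumes x: "x \<in> regular"
  shows "connected_component_set regular x = open_cell x"
proof
  show "connected_component_set regular x \<subseteq> open_cell x"
  proof
    fix y assume "y \<in> connected_component_set regular x"
    then obtain T where T: "connected T" "T \<subseteq> regular" "x \<in> T" "y \<in> T"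
      by (auto simp: connected_component_def)
    have "sgn (f y) = sgn (f x)" if f: "f \<in> P \<union> N" for f
    proof (rule ccontr)
      assume ne: "sgn (f y) \<noteq> sgn (f x)"
      have "connected (f ` T)"
        by (rule connected_continuous_image[OF continuous_on_subset[OF continuous_PN[OF f]] T(1)]) simp
      moreover have "f x \<noteq> 0" "f y \<noteq> 0" using T f regular_nonzero by blast+
      with ne have "f x \<le> 0 \<and> 0 \<le> f y \<or> f y \<le> 0 \<and> 0 \<le> f x"
        by (auto simp: sgn_if split: if_splits)
      ultimately have "0 \<in> f ` T"
        using T(3,4) connectedD_interval[of "f ` T" "f x" "f y" 0]
          connectedD_interval[of "f ` T" "f y" "f x" 0] by blast
      then show False using T(2) f regular_nonzero by fastforce
    qed
    then show "y \<in> open_cell x" using T by (auto simp: open_cell_def regular_eq)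
  qed
  show "open_cell x \<subseteq> connected_component_set regular x"
  proof
    fix y assume y: "y \<in> open_cell x"
    define line where "line t = x + t *\<^sub>R (y - x)" for t
    have xy: "x \<in> V" "y - x \<in> V" using x y subspace_V
      by (auto simp: regular_eq open_cell_def subspace_diff)
    have "line t \<in> regular" if t: "0 \<le> t" "t \<le> 1" for t
    proof -
      have sgn_eq: "sgn (f (line t)) = sgn (f x)" if f: "f \<in> P \<union> N" for f
      proof -
        have diff: "f (y - x) = f y - f x" using f linear_PN by (simp add: linear_diff)
        have eq: "f (line t) = (1 - t) * f x + t * f y"
          unfolding line_def PN_line[OF f] diff by (simp add: algebra_simps)
        have "sgn (f y) = sgn (f x)" "f x \<noteq> 0"
          using y f regular_nonzero[OF x] by (auto simp: open_cell_def)
        then consider "f x > 0" "f y > 0" | "f x < 0" "f y < 0"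
          by (auto simp: sgn_if split: if_splits)
        then show ?thesis
        proof cases
          case 1
          then have "(1 - t) * f x + t * f y > 0"
            using t by (cases "t = 0") (auto intro!: add_nonneg_pos mult_nonneg_nonneg)
          then show ?thesis using 1 eq by simp
        next
          case 2
          then have "(1 - t) * f x + t * f y < 0"
            using t by (cases "t = 0") (auto intro!: add_nonpos_neg mult_nonneg_nonpos mult_pos_neg)
          then show ?thesis using 2 eq by simp
        qed
      qed
      have "0 < f (line t)" if "f \<in> P" for f
        using sgn_eq[of f] x that by (auto simp: regular_eq sgn_if split: if_splits)
      moreover have "f (line t) \<noteq> 0" if "f \<in> N" for f
        using sgn_eq[of f] x that by (auto simp: regular_eq sgn_if split: if_splits)
      moreover have "line t \<in> V" using xy by (simp add: line_def line_in_V)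
      ultimately show ?thesis by (simp add: regular_eq)
    qed
    then have "line ` {0..1} \<subseteq> regular" by auto
    moreover have "connected (line ` {0..1})"
      unfolding line_def by (rule connected_continuous_image[OF continuous_on_line]) simp
    moreover have "line 0 = x" "line 1 = y" by (simp_all add: line_def)
    then have "x \<in> line ` {0..1}" "y \<in> line ` {0..1}" by force+
    ultimately show "y \<in> connected_component_set regular x"
      by (auto simp: connected_component_def)
  qed
qed

text \<open>
  A point \<open>y\<close> of the closed cell is the limit of the points \<open>y + t x\<close>, which lie in the open cell.
\<close>

lemma closure_open_cell:
  assumes x: "x \<in> regular"
  shows "closure (open_cell x) = closed_cell x"
proof
  have "closed_cell x = V \<inter> (\<Inter>f\<in>P \<union> N. {y. 0 \<le> f x \<longrightarrow> 0 \<le> f y} \<inter> {y. f x \<le> 0 \<longrightarrow> f y \<le> 0})"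
    by (auto simp: closed_cell_def)
  moreover have "closed ({y. 0 \<le> f x \<longrightarrow> 0 \<le> f y} \<inter> {y. f x \<le> 0 \<longrightarrow> f y \<le> 0})"
    if "f \<in> P \<union> N" for f
    using continuous_PN[OF that]
    by (intro closed_Int closed_Collect_imp open_Collect_const closed_Collect_le continuous_on_const)
  ultimately have "closed (closed_cell x)" using closed_V by (simp add: closed_Int closed_INT)
  moreover have "open_cell x \<subseteq> closed_cell x"
  proof
    fix y assume y: "y \<in> open_cell x"
    have "sgn (f y) = sgn (f x)" if "f \<in> P \<union> N" for f using y that by (simp add: open_cell_def)
    then have "(0 \<le> f x \<longrightarrow> 0 \<le> f y) \<and> (f x \<le> 0 \<longrightarrow> f y \<le> 0)" if "f \<in> P \<union> N" for f
      using that by (metis sgn_le_0_iff zero_le_sgn_iff)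
    then show "y \<in> closed_cell x" using y by (simp add: closed_cell_def open_cell_def)
  qed
  ultimately show "closure (open_cell x) \<subseteq> closed_cell x" by (rule closure_minimal[rotated])
  show "closed_cell x \<subseteq> closure (open_cell x)"
  proof
    fix y assume y: "y \<in> closed_cell x"
    have V: "x \<in> V" "y \<in> V" using x y by (auto simp: regular_eq closed_cell_def)
    have "\<forall>\<^sub>F t in at_right 0. y + t *\<^sub>R x \<in> open_cell x"
      using eventually_sgn_PN[of y x]
    proof eventually_elim
      case (elim t)
      have "sgn (f (y + t *\<^sub>R x)) = sgn (f x)" if f: "f \<in> P \<union> N" for f
      proof -
        have "sgn (f (y + t *\<^sub>R x)) = (if f y = 0 then sgn (f x) else sgn (f y))"
          using elim f by blast
        moreover have "f y = 0 \<or> sgn (f y) = sgn (f x)"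
          using y f by (simp only: closed_cell_def mem_Collect_eq weak_sign_iff)
        ultimately show ?thesis by auto
      qed
      then show ?case using V by (simp add: open_cell_def line_in_V)
    qed
    then have "\<forall>\<^sub>F t in at_right 0. y + t *\<^sub>R x \<in> closure (open_cell x)"
      by eventually_elim (rule closure_subset[THEN subsetD])
    then show "y \<in> closure (open_cell x)"
      using tendsto_line by (intro Lim_in_closed_set[OF closed_closure]) auto
  qed
qed

lemma chambers_eq: "closure ` components regular = closed_cell ` regular"
proof -
  have "components regular = open_cell ` regular"
    using regular_component by (force simp: components_def)
  then show ?thesis by (auto simp: closure_open_cell image_image)
qed

text \<open>
  One form after the other is made nonzero by a perturbation that is too small to spoil the signs obtained so
  far.
\<close>

lemma exists_regular: "\<exists>r. r \<in> regular"
proof -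
  have "\<exists>r\<in>V. (\<forall>f\<in>P. 0 < f r) \<and> (\<forall>f\<in>M. f r \<noteq> 0)" if "finite M" "M \<subseteq> N" for M
    using that
  proof (induction M)
    case empty
    then show ?case using interior_point by auto
  next
    case (insert g M)
    then obtain r where r: "r \<in> V" "\<And>f. f \<in> P \<Longrightarrow> 0 < f r" "\<And>f. f \<in> M \<Longrightarrow> f r \<noteq> 0" by auto
    obtain u where u: "u \<in> V" "g u \<noteq> 0" using insert nonzero_N by blast
    obtain t where t: "t > 0" "\<And>f. f \<in> P \<union> N \<Longrightarrow>
        sgn (f (r + t *\<^sub>R u)) = (if f r = 0 then sgn (f u) else sgn (f r))"
      using obtain_small[OF always_eventually, of "\<lambda>_. True" r u] by auto
    have "0 < f (r + t *\<^sub>R u)" if "f \<in> P" for f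
      using t(2)[of f] r(2)[of f] that by (auto simp: sgn_if split: if_splits)
    moreover have "f (r + t *\<^sub>R u) \<noteq> 0" if "f \<in> insert g M" for f
    proof -
      have "f r \<noteq> 0 \<or> f u \<noteq> 0" using that u(2) r(3) by auto
      then show ?thesis using t(2)[of f] that insert.prems by (auto simp: sgn_if split: if_splits)
    qed
    ultimately show ?case using r(1) u(1) line_in_V by blast
  qed
  from this[of N] show ?thesis using finite_PN by (auto simp: regular_eq)
qed

text \<open>
  Moving \<open>z\<close> slightly towards a regular point produces a regular point whose cell has \<open>z\<close> in its closure.
\<close>

lemma dominant_in_chamber:
  assumes z: "z \<in> dominant"
  obtains x where "x \<in> regular" "z \<in> closed_cell x"
proof -
  obtain r where r: "r \<in> regular" using exists_regular by blast
  have V: "z \<in> V" "r \<in> V" using z r by (auto simp: dominant_def regular_eq)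
  obtain t where t: "t > 0" "\<And>f. f \<in> P \<union> N \<Longrightarrow>
      sgn (f (z + t *\<^sub>R r)) = (if f z = 0 then sgn (f r) else sgn (f z))"
    using obtain_small[OF always_eventually, of "\<lambda>_. True" z r] by auto
  have "0 < f (z + t *\<^sub>R r)" if "f \<in> P" for f
  proof -
    have "f r > 0" "f z \<ge> 0" using r z that by (auto simp: regular_eq dominant_def)
    then show ?thesis using t(2)[of f] that by (auto simp: sgn_if split: if_splits)
  qed
  moreover have "f (z + t *\<^sub>R r) \<noteq> 0" if "f \<in> N" for f
    using t(2)[of f] regular_nonzero[OF r, of f] that by (auto simp: sgn_if split: if_splits)
  ultimately have "z + t *\<^sub>R r \<in> regular" using V by (simp add: regular_eq line_in_V)
  moreover have "z \<in> closed_cell (z + t *\<^sub>R r)"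
    using t(2) V by (auto simp: closed_cell_def weak_sign_iff)
  ultimately show ?thesis by (rule that)
qed

lemma closed_cell_refl: "z \<in> V \<Longrightarrow> z \<in> closed_cell z"
  by (simp add: closed_cell_def)

lemma closed_cell_trans: "y \<in> closed_cell z \<Longrightarrow> z \<in> closed_cell x \<Longrightarrow> y \<in> closed_cell x"
  by (simp add: closed_cell_def)

lemma convex_closed_cell: "convex (closed_cell z)"
proof (rule convexI)
  fix x y and u v :: real
  assume *: "x \<in> closed_cell z" "y \<in> closed_cell z" "0 \<le> u" "0 \<le> v" "u + v = 1"
  have "f (u *\<^sub>R x + v *\<^sub>R y) = u * f x + v * f y" if "f \<in> P \<union> N" for f
    using linear_PN[OF that] by (simp add: linear_add linear_scale)
  moreover have "u *\<^sub>R x + v *\<^sub>R y \<in> V"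
    using * subspace_V by (simp add: closed_cell_def subspace_add subspace_scale)
  moreover have "(0 \<le> f z \<longrightarrow> 0 \<le> u * f x + v * f y) \<and> (f z \<le> 0 \<longrightarrow> u * f x + v * f y \<le> 0)"
    if "f \<in> P \<union> N" for f
    using closed_cellD[OF *(1) that] closed_cellD[OF *(2) that] *(3,4)
    by (auto intro: add_nonneg_nonneg mult_nonneg_nonneg add_nonpos_nonpos mult_nonneg_nonpos)
  ultimately show "u *\<^sub>R x + v *\<^sub>R y \<in> closed_cell z"
    by (simp add: closed_cell_def)
qed

text \<open>
  On the closed cell of \<open>x\<close> every form has a weak sign, so a form that vanishes inside a segment vanishes at
  both ends.
\<close>

lemma closed_cell_face_of:
  assumes z: "z \<in> closed_cell x"
  shows "closed_cell z face_of closed_cell x"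
  unfolding face_of_def
proof (intro conjI ballI impI)
  show "closed_cell z \<subseteq> closed_cell x" using closed_cell_trans z by blast
  show "convex (closed_cell z)" by (rule convex_closed_cell)
  fix a b c assume abc: "a \<in> closed_cell x" "b \<in> closed_cell x" "c \<in> closed_cell z" "c \<in> open_segment a b"
  then obtain u where u: "0 < u" "u < 1" "c = (1 - u) *\<^sub>R a + u *\<^sub>R b" by (auto simp: in_segment)
  have lin: "f c = (1 - u) * f a + u * f b" if "f \<in> P \<union> N" for f
    using linear_PN[OF that] u(3) by (simp add: linear_add linear_scale)
  have both: "f a = 0 \<and> f b = 0" if f: "f \<in> P \<union> N" and "f z = 0" for f
  proof -
    have c0: "(1 - u) * f a + u * f b = 0" using lin[OF f] closed_cellD[OF abc(3) f] \<open>f z = 0\<close> by simp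
    have "0 \<le> f a \<and> 0 \<le> f b \<or> f a \<le> 0 \<and> f b \<le> 0"
      using closed_cellD[OF abc(1) f] closed_cellD[OF abc(2) f] by linarith
    then show ?thesis
    proof
      assume "0 \<le> f a \<and> 0 \<le> f b"
      then have "0 \<le> (1 - u) * f a" "0 \<le> u * f b" using u by simp_all
      then have "(1 - u) * f a = 0" "u * f b = 0" using c0 by linarith+
      then show ?thesis using u by simp
    next
      assume "f a \<le> 0 \<and> f b \<le> 0"
      then have "(1 - u) * f a \<le> 0" "u * f b \<le> 0" using u by (simp_all add: mult_nonneg_nonpos)
      then have "(1 - u) * f a = 0" "u * f b = 0" using c0 by linarith+
      then show ?thesis using u by simp
    qed
  qed
  have "d \<in> closed_cell z" if d: "d \<in> closed_cell x" "\<And>f. f \<in> P \<union> N \<Longrightarrow> f z = 0 \<Longrightarrow> f d = 0" for d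
  proof -
    have "(0 \<le> f z \<longrightarrow> 0 \<le> f d) \<and> (f z \<le> 0 \<longrightarrow> f d \<le> 0)" if f: "f \<in> P \<union> N" for f
    proof (cases "f z = 0")
      case True
      then show ?thesis using d(2)[OF f] by simp
    next
      case False
      then show ?thesis using closed_cellD[OF z f] closed_cellD[OF d(1) f] by linarith
    qed
    then show ?thesis using d(1) by (simp add: closed_cell_def)
  qed
  then show "a \<in> closed_cell z" "b \<in> closed_cell z" using abc(1,2) both by blast+
qed

text \<open>
  A point \<open>z\<close> of the face at which as many forms as possible are nonzero plays the part of a relative interior
  point. The face lies in the closed cell of \<open>z\<close> because the midpoint of \<open>z\<close> and any other point has the union of
  both supports; it contains that cell because segments in the cell can be prolonged beyond \<open>z\<close>.
\<close>

lemma face_of_closed_cell: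
  assumes x: "x \<in> regular" and F: "F face_of closed_cell x" "F \<noteq> {}"
  obtains z where "z \<in> closed_cell x" "F = closed_cell z"
proof -
  define supp where "supp z = {f \<in> P \<union> N. f z \<noteq> 0}" for z
  have fin: "finite (supp z)" for z using finite_PN by (simp add: supp_def)
  have sub: "F \<subseteq> closed_cell x" and conv: "convex F" using F by (auto simp: face_of_def)
  obtain z0 where z0: "z0 \<in> F" using F by blast
  \<comment> \<open>a point of maximal support\<close>
  have "card (supp y) < Suc (card (P \<union> N))" for y
    unfolding supp_def less_Suc_eq_le by (rule card_mono[OF finite_PN]) blast
  then obtain z where z: "z \<in> F" "\<And>y. y \<in> F \<Longrightarrow> card (supp y) \<le> card (supp z)"
    using ex_has_greatest_nat[of "\<lambda>y. y \<in> F" z0 "\<lambda>y. card (supp y)" "Suc (card (P \<union> N))", OF z0]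
    by blast
  have zx: "z \<in> closed_cell x" using z sub by blast
  have "y \<in> closed_cell z" if y: "y \<in> F" for y
  proof -
    define w where "w = (1/2) *\<^sub>R z + (1/2) *\<^sub>R y"
    have w: "w \<in> F" unfolding w_def using conv z(1) y by (rule convexD) auto
    have fw: "f w = (f z + f y) / 2" if "f \<in> P \<union> N" for f
      using linear_PN[OF that] by (simp add: w_def linear_add linear_scale)
    have same: "0 \<le> f z \<and> 0 \<le> f y \<or> f z \<le> 0 \<and> f y \<le> 0" if f: "f \<in> P \<union> N" for f
      using closed_cellD[OF zx f] closed_cellD[OF subsetD[OF sub y] f] by linarith
    have un: "supp z \<union> supp y \<subseteq> supp w"
    proof
      fix f assume f: "f \<in> supp z \<union> supp y"
      then have "f \<in> P \<union> N" by (auto simp: supp_def)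
      then show "f \<in> supp w" using fw[of f] same[of f] f by (auto simp: supp_def)
    qed
    then have "supp z = supp w" using z(2)[OF w] fin by (intro card_seteq) auto
    then have "supp y \<subseteq> supp z" using un by blast
    then have "(0 \<le> f z \<longrightarrow> 0 \<le> f y) \<and> (f z \<le> 0 \<longrightarrow> f y \<le> 0)" if f: "f \<in> P \<union> N" for f
      using same[OF f] f by (cases "f z = 0") (auto simp: supp_def)
    then show ?thesis using y sub by (auto simp: closed_cell_def)
  qed
  moreover have "y \<in> F" if y: "y \<in> closed_cell z" for y
  proof (cases "y = z")
    case False
    have V: "z \<in> V" "z - y \<in> V" using zx y subspace_V by (auto simp: closed_cell_def subspace_diff)
    obtain t where t: "t > 0" "\<And>f. f \<in> P \<union> N \<Longrightarrow>
        sgn (f (z + t *\<^sub>R (z - y))) = (if f z = 0 then sgn (f (z - y)) else sgn (f z))"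
      using obtain_small[OF always_eventually, of "\<lambda>_. True" z "z - y"] by auto
    \<comment> \<open>the prolongation of the segment from \<open>y\<close> to \<open>z\<close>\<close>
    define z' where "z' = z + t *\<^sub>R (z - y)"
    have "(0 \<le> f z \<longrightarrow> 0 \<le> f z') \<and> (f z \<le> 0 \<longrightarrow> f z' \<le> 0)" if f: "f \<in> P \<union> N" for f
    proof (cases "f z = 0")
      case True
      then have "f y = 0" using closed_cellD[OF y f] by simp
      then have "f (z - y) = 0" using True linear_PN[OF f] by (simp add: linear_diff)
      then show ?thesis using True PN_line[OF f] by (simp add: z'_def)
    next
      case False
      then show ?thesis using t(2)[OF f] by (auto simp: z'_def sgn_if split: if_splits)
    qed
    then have "z' \<in> closed_cell z" using V by (simp add: closed_cell_def z'_def line_in_V)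
    then have z': "z' \<in> closed_cell x" using closed_cell_trans zx by blast
    have "y \<noteq> z'"
    proof
      assume "y = z'"
      then have "(1 + t) *\<^sub>R (z - y) = 0" by (simp add: z'_def algebra_simps)
      then show False using t(1) False by simp
    qed
    moreover have "z = (1 - 1 / (1 + t)) *\<^sub>R y + (1 / (1 + t)) *\<^sub>R z'"
    proof -
      have "(1 / (1 + t)) * t = 1 - 1 / (1 + t)" using t(1) by (simp add: field_simps)
      then have "(1 / (1 + t)) *\<^sub>R z' = (1 / (1 + t)) *\<^sub>R z + (1 - 1 / (1 + t)) *\<^sub>R (z - y)"
        by (simp only: z'_def scaleR_add_right scaleR_scaleR)
      then show ?thesis by (simp add: scaleR_diff_right scaleR_diff_left)
    qed
    ultimately have "z \<in> open_segment y z'"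
      using t(1) by (auto simp: in_segment intro!: exI[of _ "1 / (1 + t)"])
    then show ?thesis
      using face_ofD[OF F(1) _ _ z'] z(1) closed_cell_trans[OF y zx] by blast
  qed (use z in simp)
  ultimately show ?thesis using that zx by blast
qed

theorem faces_eq: "{F. F \<noteq> {} \<and> (\<exists>C \<in> closure ` components regular. F face_of C)} = closed_cell ` dominant"
proof (intro equalityI subsetI)
  fix F assume "F \<in> {F. F \<noteq> {} \<and> (\<exists>C \<in> closure ` components regular. F face_of C)}"
  then obtain x where x: "x \<in> regular" "F face_of closed_cell x" "F \<noteq> {}"
    by (auto simp: chambers_eq)
  then obtain z where z: "z \<in> closed_cell x" "F = closed_cell z" by (rule face_of_closed_cell)
  then have "z \<in> dominant" using x by (auto simp: closed_cell_def dominant_def regular_eq less_imp_le)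
  then show "F \<in> closed_cell ` dominant" using z by blast
next
  fix F assume "F \<in> closed_cell ` dominant"
  then obtain z where z: "z \<in> dominant" "F = closed_cell z" by blast
  obtain x where x: "x \<in> regular" "z \<in> closed_cell x" using z(1) by (rule dominant_in_chamber)
  have "F \<noteq> {}" using z closed_cell_refl by (auto simp: dominant_def)
  then show "F \<in> {F. F \<noteq> {} \<and> (\<exists>C \<in> closure ` components regular. F face_of C)}"
    using x z closed_cell_face_of by (auto simp: chambers_eq)
qed

lemma closed_cell_eq_iff:
  assumes "z \<in> V" "z' \<in> V"
  shows "closed_cell z = closed_cell z' \<longleftrightarrow> (\<forall>f\<in>P \<union> N. sgn (f z) = sgn (f z'))"
proof
  assume "closed_cell z = closed_cell z'"
  then have "z \<in> closed_cell z'" "z' \<in> closed_cell z" using assms closed_cell_refl by blast+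
  then have cells: "z \<in> closed_cell z'" "z' \<in> closed_cell z" .
  show "\<forall>f\<in>P \<union> N. sgn (f z) = sgn (f z')"
  proof
    fix f assume f: "f \<in> P \<union> N"
    show "sgn (f z) = sgn (f z')"
      using closed_cellD[OF cells(1) f] closed_cellD[OF cells(2) f] by (auto simp: sgn_if)
  qed
next
  assume "\<forall>f\<in>P \<union> N. sgn (f z) = sgn (f z')"
  then show "closed_cell z = closed_cell z'" by (simp add: closed_cell_def weak_sign_iff)
qed

text \<open>
  A vector \<open>y\<close> at which all forms vanish that vanish at \<open>z\<close> is a multiple of the difference of the two points
  \<open>z + t y\<close> and \<open>z\<close> of the cell, for a small positive \<open>t\<close>.
\<close>

lemma span_closed_cell:
  assumes "z \<in> V"
  shows "span (closed_cell z) = {y \<in> V. \<forall>f\<in>P \<union> N. f z = 0 \<longrightarrow> f y = 0}" (is "_ = ?U")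
proof
  have "subspace ?U"
    using subspace_V linear_PN unfolding subspace_def
    by (auto simp: linear_0 linear_add linear_scale)
  moreover have "closed_cell z \<subseteq> ?U"
  proof
    fix y assume y: "y \<in> closed_cell z"
    then show "y \<in> ?U"
      using closed_cellD[OF y] by (simp add: closed_cell_def order_antisym)
  qed
  ultimately show "span (closed_cell z) \<subseteq> ?U" by (intro span_minimal)
  show "?U \<subseteq> span (closed_cell z)"
  proof
    fix y assume y: "y \<in> ?U"
    obtain t where t: "t > 0" "\<And>f. f \<in> P \<union> N \<Longrightarrow>
        sgn (f (z + t *\<^sub>R y)) = (if f z = 0 then sgn (f y) else sgn (f z))"
      using obtain_small[OF always_eventually, of "\<lambda>_. True" z y] by auto
    have "sgn (f (z + t *\<^sub>R y)) = sgn (f z)" if "f \<in> P \<union> N" for f using t(2)[OF that] y that by auto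
    then have "z + t *\<^sub>R y \<in> closed_cell z"
      using closed_cell_eq_iff[of "z + t *\<^sub>R y" z] closed_cell_refl[of "z + t *\<^sub>R y"] y assms
      by (simp add: line_in_V)
    then have "(1 / t) *\<^sub>R ((z + t *\<^sub>R y) - z) \<in> span (closed_cell z)"
      using closed_cell_refl[OF assms] by (intro span_scale span_diff span_base)
    then show "y \<in> span (closed_cell z)" using t(1) by simp
  qed
qed

end

section \<open>The arrangement of weights on the space of trace zero\<close>

definition walls :: "nat \<Rightarrow> ((nat \<Rightarrow> real) \<Rightarrow> real) set" where
  "walls n = {(\<lambda>x. x i - x (Suc i)) | i. Suc i < n}"

lemma cartan_sl_eq: "cartan_sl n = {x. (\<forall>i\<ge>n. x i = 0) \<and> (\<Sum>i<n. x i) = 0}"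
  by (simp add: cartan_sl_def topspace_Euclidean_space)

lemma walls_weights_cases:
  assumes "f \<in> walls n \<union> weights n"
  obtains i where "Suc i < n" "f = (\<lambda>x. x i - x (Suc i))"
    | i where "i < n" "f = (\<lambda>x. x i)"
    | i j where "i < j" "j < n" "f = (\<lambda>x. x i + x j)"
  using assms by (auto simp: walls_def weights_def)

lemma weights_nonzero_weights: "f \<in> weights n \<Longrightarrow> f \<notin> nonzero_weights n \<Longrightarrow> x \<in> cartan_sl n \<Longrightarrow> f x = 0"
  by (auto simp: nonzero_weights_def)

interpretation sl: chamber_arrangement "cartan_sl n" "walls n" "nonzero_weights n" for n
proof (rule chamber_arrangement.intro)
  show "subspace (cartan_sl n)"
    by (auto simp: subspace_def cartan_sl_eq sum.distrib simp flip: sum_distrib_left)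
  have "cartan_sl n = (\<Inter>i\<in>{n..}. {x. x i = 0}) \<inter> {x. (\<Sum>i<n. x i) = 0}"
    by (auto simp: cartan_sl_eq)
  also have "closed \<dots>"
    by (intro closed_Int closed_INT ballI closed_Collect_eq continuous_intros)
       (auto intro!: continuous_intros)
  finally show "closed (cartan_sl n)" .
  have "finite (weights n)"
  proof -
    have "weights n \<subseteq> (\<lambda>i x. x i) ` {..<n} \<union> (\<lambda>(i, j) x. x i + x j) ` ({..<n} \<times> {..<n})"
      by (force simp: weights_def image_iff)
    then show ?thesis by (rule finite_subset) auto
  qed
  moreover have "finite (walls n)"
  proof -
    have "walls n \<subseteq> (\<lambda>i x. x i - x (Suc i)) ` {..<n}" by (auto simp: walls_def)
    then show ?thesis by (rule finite_subset) auto
  qed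
  moreover have sub: "nonzero_weights n \<subseteq> weights n" by (auto simp: nonzero_weights_def)
  ultimately show "finite (walls n \<union> nonzero_weights n)" by (auto intro: finite_subset)
  show "linear f" if "f \<in> walls n \<union> nonzero_weights n" for f
  proof -
    have "f \<in> walls n \<union> weights n" using that sub by blast
    then show ?thesis by (cases rule: walls_weights_cases) (auto intro!: linearI simp: algebra_simps)
  qed
  show "continuous_on UNIV f" if "f \<in> walls n \<union> nonzero_weights n" for f
  proof -
    have "f \<in> walls n \<union> weights n" using that sub by blast
    then show ?thesis by (cases rule: walls_weights_cases) (auto intro!: continuous_intros)
  qed
  show "\<exists>u\<in>cartan_sl n. f u \<noteq> 0" if "f \<in> nonzero_weights n" for f
    using that by (auto simp: nonzero_weights_def)
  \<comment> \<open>a decreasing arithmetic progression with mean zero\<close>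
  define b :: "nat \<Rightarrow> real" where "b i = (if i < n then (real n - 1) / 2 - real i else 0)" for i
  have "(\<Sum>i<n. b i) = real n * ((real n - 1) / 2) - (\<Sum>i<n. real i)"
    by (simp add: b_def sum_subtractf)
  also have "(\<Sum>i<n. real i) = real n * (real n - 1) / 2"
    by (induction n) (simp_all add: field_simps)
  finally have "b \<in> cartan_sl n" by (simp add: cartan_sl_eq b_def)
  moreover have "f b > 0" if "f \<in> walls n" for f
    using that by (auto simp: walls_def b_def)
  ultimately show "\<exists>b\<in>cartan_sl n. \<forall>f\<in>walls n. f b > 0" by blast
qed

lemma dominant_eq_weyl_chamber: "sl.dominant n = weyl_chamber_sl n"
  unfolding sl.dominant_def by (auto simp: weyl_chamber_sl_def walls_def)

lemma faces_eq_closed_cells: "faces n = sl.closed_cell n ` weyl_chamber_sl n"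
  using sl.faces_eq[of n]
  by (simp add: faces_def chambers_def regular_points_def sl.regular_def dominant_eq_weyl_chamber)

lemma weyl_cartan: "z \<in> weyl_chamber_sl n \<Longrightarrow> z \<in> cartan_sl n"
  by (simp add: weyl_chamber_sl_def)

lemma weyl_decreasing:
  assumes "x \<in> weyl_chamber_sl n" "i \<le> j" "j < n"
  shows "x j \<le> x i"
  using assms(2,3)
proof (induction j rule: dec_induct)
  case (step k)
  then have "x (Suc k) \<le> x k" using assms(1) by (simp add: weyl_chamber_sl_def)
  then show ?case using step by simp
qed simp

text \<open>
  For the properties of interest a weight that is identically zero on the space makes no difference, so one may
  quantify over all weights.
\<close>

lemma ball_walls_weights:
  assumes "\<And>f. f \<in> weights n \<Longrightarrow> f \<notin> nonzero_weights n \<Longrightarrow> Q f"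
  shows "(\<forall>f\<in>walls n \<union> nonzero_weights n. Q f) \<longleftrightarrow>
    (\<forall>i. Suc i < n \<longrightarrow> Q (\<lambda>x. x i - x (Suc i))) \<and> (\<forall>i<n. Q (\<lambda>x. x i)) \<and>
    (\<forall>i j. i < j \<and> j < n \<longrightarrow> Q (\<lambda>x. x i + x j))"
proof -
  have "(\<forall>f\<in>walls n \<union> nonzero_weights n. Q f) \<longleftrightarrow> (\<forall>f\<in>walls n. Q f) \<and> (\<forall>f\<in>weights n. Q f)"
    using assms by (auto simp: nonzero_weights_def)
  then show ?thesis by (auto simp: walls_def weights_def)
qed

lemma closed_cell_sl_eq_iff:
  assumes "z \<in> cartan_sl n" "z' \<in> cartan_sl n"
  shows "sl.closed_cell n z = sl.closed_cell n z' \<longleftrightarrow>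
    (\<forall>i. Suc i < n \<longrightarrow> sgn (z i - z (Suc i)) = sgn (z' i - z' (Suc i))) \<and>
    (\<forall>i<n. \<forall>j<n. sgn (z i + z j) = sgn (z' i + z' j))"
proof -
  have "(\<forall>i<n. sgn (z i) = sgn (z' i)) \<and> (\<forall>i j. i < j \<and> j < n \<longrightarrow> sgn (z i + z j) = sgn (z' i + z' j))
      \<longleftrightarrow> (\<forall>i<n. \<forall>j<n. sgn (z i + z j) = sgn (z' i + z' j))" (is "?L \<longleftrightarrow> ?R")
  proof
    assume L: ?L
    show ?R
    proof (intro allI impI)
      fix i j assume "i < n" "j < n"
      then show "sgn (z i + z j) = sgn (z' i + z' j)"
      proof (cases i j rule: linorder_cases)
        case greater
        then have "sgn (z j + z i) = sgn (z' j + z' i)" using L \<open>i < n\<close> by blast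
        then show ?thesis by (simp add: add.commute)
      qed (use L \<open>i < n\<close> \<open>j < n\<close> in \<open>simp_all add: sgn_mult flip: mult_2\<close>)
    qed
  next
    assume R: ?R
    then have "sgn (z i) = sgn (z' i)" if "i < n" for i
      using R[rule_format, OF that that] by (simp add: sgn_mult flip: mult_2)
    then show ?L using R by auto
  qed
  then show ?thesis
    using assms unfolding sl.closed_cell_eq_iff[OF assms]
    by (subst ball_walls_weights) (auto simp: weights_nonzero_weights)
qed

text \<open>
  Between equal coordinates of a decreasing sequence all steps are equalities.
\<close>

lemma equal_coordinates:
  assumes z: "z \<in> weyl_chamber_sl n" and eq: "\<And>i. Suc i < n \<Longrightarrow> z i = z (Suc i) \<Longrightarrow> z' i = z' (Suc i)"
    and ij: "i < n" "j < n" "z i = z j"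
  shows "z' i = z' j"
proof -
  have *: "z' i = z' j" if "i \<le> j" "j < n" "z i = z j" for i j
    using that
  proof (induction j rule: dec_induct)
    case base
    show ?case by (rule refl)
  next
    case (step k)
    have "z k \<le> z i" "z (Suc k) \<le> z k"
      using weyl_decreasing[OF z, of i k] weyl_decreasing[OF z, of k "Suc k"] step by simp_all
    then have zk: "z i = z k" "z k = z (Suc k)" using step.prems by simp_all
    have "z' i = z' k" by (rule step.IH) (use step.prems zk in simp_all)
    also have "\<dots> = z' (Suc k)" by (rule eq) (use step.prems zk in simp_all)
    finally show ?case .
  qed
  show ?thesis
  proof (cases "i \<le> j")
    case True
    then show ?thesis using * ij by blast
  next
    case False
    then have "z' j = z' i" using ij by (intro *) auto
    then show ?thesis by (rule sym)
  qed
qed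

section \<open>The word of a point\<close>

definition abs_values :: "nat \<Rightarrow> (nat \<Rightarrow> real) \<Rightarrow> real set" where
  "abs_values n z = (\<lambda>i. \<bar>z i\<bar>) ` {..<n} - {0}"

definition levels :: "nat \<Rightarrow> (nat \<Rightarrow> real) \<Rightarrow> real list" where
  "levels n z = rev (sorted_list_of_set (abs_values n z))"

definition fibre_card :: "nat \<Rightarrow> (nat \<Rightarrow> real) \<Rightarrow> real \<Rightarrow> nat" where
  "fibre_card n z v = card {i. i < n \<and> z i = v}"

text \<open>
  The letter of a level \<open>v\<close> counts the coordinates equal to \<open>v\<close> and those equal to \<open>- v\<close>. The number of
  vanishing coordinates is what remains up to \<open>n\<close>.
\<close>

definition level_word :: "nat \<Rightarrow> (nat \<Rightarrow> real) \<Rightarrow> (nat \<times> nat) list" where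
  "level_word n z = map (\<lambda>v. (fibre_card n z v, fibre_card n z (- v))) (levels n z)"

lemma finite_abs_values [simp]: "finite (abs_values n z)"
  by (simp add: abs_values_def)

lemma set_levels [simp]: "set (levels n z) = abs_values n z"
  by (simp add: levels_def)

lemma distinct_levels: "distinct (levels n z)"
  by (simp add: levels_def)

lemma levels_decreasing: "sorted_wrt (>) (levels n z)"
  by (simp add: levels_def sorted_wrt_rev)

lemma levels_eqI:
  assumes "sorted_wrt (>) vs" "set vs = abs_values n z"
  shows "levels n z = vs"
proof -
  have "sorted_wrt (<) (rev vs)" using assms(1) by (simp add: sorted_wrt_rev)
  then have "sorted_list_of_set (set (rev vs)) = rev vs"
    by (intro sorted_list_of_set.idem_if_sorted_distinct) (auto simp: strict_sorted_iff)
  then show ?thesis using assms(2) by (simp add: levels_def)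
qed

lemma length_level_word [simp]: "length (level_word n z) = length (levels n z)"
  by (simp add: level_word_def)

lemma abs_values_pos: "v \<in> abs_values n z \<Longrightarrow> 0 < v"
  by (auto simp: abs_values_def)

text \<open>
  The information in the signs of the walls and weights, in a form that refers to absolute values.
\<close>

definition same_order :: "nat \<Rightarrow> (nat \<Rightarrow> real) \<Rightarrow> (nat \<Rightarrow> real) \<Rightarrow> bool" where
  "same_order n z z' \<longleftrightarrow> (\<forall>i<n. sgn (z i) = sgn (z' i)) \<and> (\<forall>i<n. \<forall>j<n. \<bar>z i\<bar> \<le> \<bar>z j\<bar> \<longleftrightarrow> \<bar>z' i\<bar> \<le> \<bar>z' j\<bar>)"

lemma same_order_if_signs:
  assumes z: "z \<in> weyl_chamber_sl n" and z': "z' \<in> weyl_chamber_sl n"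
    and wall: "\<And>i. Suc i < n \<Longrightarrow> sgn (z i - z (Suc i)) = sgn (z' i - z' (Suc i))"
    and weight: "\<And>i j. i < n \<Longrightarrow> j < n \<Longrightarrow> sgn (z i + z j) = sgn (z' i + z' j)"
  shows "same_order n z z'"
proof -
  have sgn_eq: "sgn (z i) = sgn (z' i)" if "i < n" for i
    using weight[OF that that] by (simp add: sgn_mult flip: mult_2)
  have wall0: "z i = z (Suc i) \<longleftrightarrow> z' i = z' (Suc i)" if "Suc i < n" for i
    using wall[OF that] by (metis right_minus_eq sgn_eq_0_iff)
  have eq: "z i = z j \<longleftrightarrow> z' i = z' j" if "i < n" "j < n" for i j
    using equal_coordinates[OF z _ that, of z'] equal_coordinates[OF z' _ that, of z] wall0 by blast
  have le: "z i \<le> z j \<longleftrightarrow> z' i \<le> z' j" if ij: "i < n" "j < n" for i j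
    using weyl_decreasing[OF z, of i j] weyl_decreasing[OF z', of i j]
      weyl_decreasing[OF z, of j i] weyl_decreasing[OF z', of j i] eq[OF ij] ij
    by (cases "i \<le> j") auto
  have sum: "z i + z j \<le> 0 \<longleftrightarrow> z' i + z' j \<le> 0" "0 \<le> z i + z j \<longleftrightarrow> 0 \<le> z' i + z' j"
    if "i < n" "j < n" for i j
    using weight[OF that] by (auto simp: sgn_if split: if_splits)
  have pos: "0 \<le> z i \<longleftrightarrow> 0 \<le> z' i" if "i < n" for i
    using sgn_eq[OF that] by (auto simp: sgn_if split: if_splits)
  have "\<bar>z i\<bar> \<le> \<bar>z j\<bar> \<longleftrightarrow> \<bar>z' i\<bar> \<le> \<bar>z' j\<bar>" if ij: "i < n" "j < n" for i j
    using pos[OF ij(1)] pos[OF ij(2)] sum[OF ij] le[OF ij] le[OF ij(2) ij(1)]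
    by (cases "0 \<le> z i"; cases "0 \<le> z j") (simp_all add: abs_if, linarith+)
  then show ?thesis using sgn_eq by (simp add: same_order_def)
qed

lemma abs_eq_sgn_eq:
  fixes a b v w :: real
  assumes "\<bar>a\<bar> = v \<longleftrightarrow> \<bar>b\<bar> = w" "0 < v" "0 < w" "sgn a = sgn b"
  shows "(b = w \<longleftrightarrow> a = v) \<and> (b = - w \<longleftrightarrow> a = - v)"
proof -
  consider "a > 0" "b > 0" | "a = 0" "b = 0" | "a < 0" "b < 0"
    using assms(4) by (auto simp: sgn_if split: if_splits)
  then show ?thesis using assms(1-3) by cases auto
qed

text \<open>
  Sending \<open>\<bar>z i\<bar>\<close> to \<open>\<bar>z' i\<bar>\<close> is a well defined increasing bijection of the levels, and it
  preserves how often a level is attained with either sign.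
\<close>

lemma word_eq_if_same_order:
  assumes same: "same_order n z z'"
  shows "level_word n z = level_word n z'"
proof -
  \<comment> \<open>the bijection of levels\<close>
  define F where "F v = \<bar>z' (SOME i. i < n \<and> \<bar>z i\<bar> = v)\<bar>" for v
  have le: "\<bar>z i\<bar> \<le> \<bar>z j\<bar> \<longleftrightarrow> \<bar>z' i\<bar> \<le> \<bar>z' j\<bar>" if "i < n" "j < n" for i j
    using same that by (simp add: same_order_def)
  have eq: "\<bar>z i\<bar> = \<bar>z j\<bar> \<longleftrightarrow> \<bar>z' i\<bar> = \<bar>z' j\<bar>" if "i < n" "j < n" for i j
    using le[OF that] le[OF that(2) that(1)] by linarith
  have sg: "sgn (z i) = sgn (z' i)" if "i < n" for i
    using same that by (simp add: same_order_def)
  have F: "F \<bar>z i\<bar> = \<bar>z' i\<bar>" if "i < n" for i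
  proof -
    have "(SOME k. k < n \<and> \<bar>z k\<bar> = \<bar>z i\<bar>) < n \<and> \<bar>z (SOME k. k < n \<and> \<bar>z k\<bar> = \<bar>z i\<bar>)\<bar> = \<bar>z i\<bar>"
      by (rule someI[of _ i]) (use that in simp)
    then show ?thesis using eq that unfolding F_def by blast
  qed
  have nz: "z i = 0 \<longleftrightarrow> z' i = 0" if "i < n" for i using sg[OF that] by (metis sgn_eq_0_iff)
  have img: "F ` abs_values n z = abs_values n z'"
  proof -
    have "abs_values n y = (\<lambda>i. \<bar>y i\<bar>) ` {i. i < n \<and> y i \<noteq> 0}" for y :: "nat \<Rightarrow> real"
      by (auto simp: abs_values_def)
    moreover have "F ` (\<lambda>i. \<bar>z i\<bar>) ` {i. i < n \<and> z i \<noteq> 0} = (\<lambda>i. \<bar>z' i\<bar>) ` {i. i < n \<and> z' i \<noteq> 0}"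
      unfolding image_image using F nz by (intro image_cong) auto
    ultimately show ?thesis by simp
  qed
  have mono: "F v > F v'" if "v \<in> abs_values n z" "v' \<in> abs_values n z" "v > v'" for v v'
    using that F le by (auto simp: abs_values_def) (metis not_le)
  have "levels n z' = map F (levels n z)"
  proof (rule levels_eqI)
    show "sorted_wrt (>) (map F (levels n z))"
      unfolding sorted_wrt_map
      by (rule sorted_wrt_mono_rel[OF _ levels_decreasing]) (use mono in auto)
    show "set (map F (levels n z)) = abs_values n z'" by (simp add: img)
  qed
  moreover have "fibre_card n z' (F v) = fibre_card n z v \<and> fibre_card n z' (- F v) = fibre_card n z (- v)"
    if v: "v \<in> abs_values n z" for v
  proof -
    obtain k where k: "k < n" "v = \<bar>z k\<bar>" "z k \<noteq> 0" using v by (auto simp: abs_values_def)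
    have F_iff: "(z' i = F v \<longleftrightarrow> z i = v) \<and> (z' i = - F v \<longleftrightarrow> z i = - v)" if "i < n" for i
    proof (rule abs_eq_sgn_eq)
      show "\<bar>z i\<bar> = v \<longleftrightarrow> \<bar>z' i\<bar> = F v" using eq[OF that k(1)] F[OF k(1)] k(2) by simp
      show "0 < v" using k by simp
      show "0 < F v" using F[OF k(1)] k nz[OF k(1)] by simp
      show "sgn (z i) = sgn (z' i)" by (rule sg[OF that])
    qed
    have "{i. i < n \<and> z' i = F v} = {i. i < n \<and> z i = v}" "{i. i < n \<and> z' i = - F v} = {i. i < n \<and> z i = - v}"
      using F_iff by blast+
    then show ?thesis by (simp add: fibre_card_def)
  qed
  ultimately show ?thesis by (simp add: level_word_def)
qed

lemma mem_downward_closed: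
  fixes S :: "nat set"
  assumes "finite S" "\<And>i j. i \<in> S \<Longrightarrow> j \<le> i \<Longrightarrow> j \<in> S"
  shows "i \<in> S \<longleftrightarrow> i < card S"
proof (cases "S = {}")
  case False
  then have "S = {..Max S}"
    using assms(2)[OF Max_in[OF assms(1) False]] Max_ge[OF assms(1)] by blast
  then have "card S = Suc (Max S)" by (metis card_atMost)
  then show ?thesis using \<open>S = {..Max S}\<close> by (metis atMost_iff less_Suc_eq_le)
qed simp

lemma levels_nth_le_iff:
  assumes "k < length (levels n z)" "l < length (levels n z)"
  shows "levels n z ! k \<le> levels n z ! l \<longleftrightarrow> l \<le> k"
  using sorted_wrt_nth_less[OF levels_decreasing, of k l] sorted_wrt_nth_less[OF levels_decreasing, of l k] assms
  by (cases k l rule: linorder_cases) fastforce+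

lemma levels_nth_mem: "k < length (levels n z) \<Longrightarrow> levels n z ! k \<in> abs_values n z"
  using nth_mem[of k "levels n z"] by simp

lemma levels_nth_pos: "k < length (levels n z) \<Longrightarrow> 0 < levels n z ! k"
  using levels_nth_mem abs_values_pos by blast

lemma level_index:
  assumes "i < n" "z i \<noteq> 0"
  obtains l where "l < length (levels n z)" "levels n z ! l = \<bar>z i\<bar>"
proof -
  have "\<bar>z i\<bar> \<in> set (levels n z)" using assms by (simp add: abs_values_def)
  then show ?thesis using that unfolding in_set_conv_nth by blast
qed

lemma card_above_level:
  assumes "j < length (levels n z)"
  shows "card {k. k < n \<and> levels n z ! j \<le> z k} = (\<Sum>l\<le>j. fibre_card n z (levels n z ! l))"
proof -
  have "{k. k < n \<and> levels n z ! j \<le> z k} = (\<Union>l\<in>{..j}. {k. k < n \<and> z k = levels n z ! l})" (is "?L = ?R")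
  proof
    show "?L \<subseteq> ?R"
    proof
      fix k assume k: "k \<in> ?L"
      then have "z k > 0" using levels_nth_pos[OF assms] by auto
      then obtain l where l: "l < length (levels n z)" "levels n z ! l = \<bar>z k\<bar>"
        using level_index[of k n z] k by auto
      then have "l \<le> j" using levels_nth_le_iff[OF assms l(1)] k \<open>z k > 0\<close> by auto
      moreover have "z k = levels n z ! l" using l(2) \<open>z k > 0\<close> by simp
      ultimately show "k \<in> ?R" using k by blast
    qed
    show "?R \<subseteq> ?L" using levels_nth_le_iff[OF assms] assms by auto
  qed
  moreover have "card ?R = (\<Sum>l\<le>j. card {k. k < n \<and> z k = levels n z ! l})"
  proof (rule card_UN_disjoint)
    show "\<forall>l\<in>{..j}. \<forall>l'\<in>{..j}. l \<noteq> l' \<longrightarrow>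
        {k. k < n \<and> z k = levels n z ! l} \<inter> {k. k < n \<and> z k = levels n z ! l'} = {}"
    proof (intro ballI impI)
      fix l l' assume "l \<in> {..j}" "l' \<in> {..j}" "l \<noteq> l'"
      then have "levels n z ! l \<noteq> levels n z ! l'"
        using nth_eq_iff_index_eq[OF distinct_levels, of l n z l'] assms by simp
      then show "{k. k < n \<and> z k = levels n z ! l} \<inter> {k. k < n \<and> z k = levels n z ! l'} = {}" by auto
    qed
  qed auto
  ultimately show ?thesis by (simp add: fibre_card_def)
qed

lemma levels_uminus: "levels n (\<lambda>i. - z i) = levels n z"
  by (simp add: levels_def abs_values_def)

lemma fibre_card_uminus: "fibre_card n (\<lambda>i. - z i) v = fibre_card n z (- v)"
proof -
  have "{i. i < n \<and> - z i = v} = {i. i < n \<and> z i = - v}" by auto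
  then show ?thesis by (simp add: fibre_card_def)
qed

text \<open>
  The coordinates decrease, so those above a given level form an initial segment, whose length can be read off
  the word. This is how a word determines the signs of its points.
\<close>

lemma level_le_iff:
  assumes z: "z \<in> weyl_chamber_sl n" and "i < n" "j < length (levels n z)"
  shows "levels n z ! j \<le> z i \<longleftrightarrow> i < (\<Sum>l\<le>j. fst (level_word n z ! l))"
proof -
  have "i \<in> {k. k < n \<and> levels n z ! j \<le> z k} \<longleftrightarrow> i < card {k. k < n \<and> levels n z ! j \<le> z k}"
    by (rule mem_downward_closed) (use weyl_decreasing[OF z] in \<open>auto intro: order_trans\<close>)
  moreover have "(\<Sum>l\<le>j. fibre_card n z (levels n z ! l)) = (\<Sum>l\<le>j. fst (level_word n z ! l))"
    using assms(3) by (intro sum.cong) (auto simp: level_word_def)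
  ultimately show ?thesis using card_above_level[OF assms(3)] assms(2) by simp
qed

lemma le_uminus_level_iff:
  assumes z: "z \<in> weyl_chamber_sl n" and "i < n" "j < length (levels n z)"
  shows "z i \<le> - levels n z ! j \<longleftrightarrow> n - (\<Sum>l\<le>j. snd (level_word n z ! l)) \<le> i"
proof -
  let ?U = "{k. k < n \<and> - levels n z ! j < z k}"
  have "i \<in> ?U \<longleftrightarrow> i < card ?U"
    by (rule mem_downward_closed) (use weyl_decreasing[OF z] in \<open>auto intro: less_le_trans\<close>)
  moreover have "card {k. k < n \<and> levels n z ! j \<le> - z k} = (\<Sum>l\<le>j. snd (level_word n z ! l))"
  proof -
    have "(\<Sum>l\<le>j. fibre_card n z (- (levels n z ! l))) = (\<Sum>l\<le>j. snd (level_word n z ! l))"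
      using assms(3) by (intro sum.cong) (auto simp: level_word_def)
    then show ?thesis
      using card_above_level[of j n "\<lambda>i. - z i"] assms(3) by (simp add: levels_uminus fibre_card_uminus)
  qed
  moreover have "?U = {..<n} - {k. k < n \<and> levels n z ! j \<le> - z k}" by auto
  then have "card ?U = n - card {k. k < n \<and> levels n z ! j \<le> - z k}"
    by (simp add: card_Diff_subset subset_iff)
  ultimately show ?thesis using assms(2) by auto
qed

text \<open>
  Two different real numbers \<open>z i\<close> and \<open>\<plusminus> z j\<close> are separated by a level or its negative: the absolute value
  of one of the two will do.
\<close>

lemma signs_of_levels:
  fixes n z
  defines "up i l \<equiv> levels n z ! l \<le> z i" and "down i l \<equiv> z i \<le> - levels n z ! l"
  assumes ij: "i < n" "j < n"
  shows "0 < z i + z j \<longleftrightarrow> (\<exists>l<length (levels n z). up i l \<and> \<not> down j l \<or> up j l \<and> \<not> down i l)"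
    and "z i + z j < 0 \<longleftrightarrow> (\<exists>l<length (levels n z). down i l \<and> \<not> up j l \<or> down j l \<and> \<not> up i l)"
    and "z j < z i \<longleftrightarrow> (\<exists>l<length (levels n z). up i l \<and> \<not> up j l \<or> down j l \<and> \<not> down i l)"
proof -
  have pos: "\<exists>l<length (levels n z). levels n z ! l = z i" if "i < n" "0 < z i" for i
    using level_index[of i n z] that by (metis abs_of_pos less_irrefl)
  have neg: "\<exists>l<length (levels n z). levels n z ! l = - z i" if "i < n" "z i < 0" for i
    using level_index[of i n z] that by (metis abs_of_neg less_irrefl)
  have sum_pos: "\<exists>l<length (levels n z). up i l \<and> \<not> down j l" if "i < n" "j < n" "0 < z i + z j" "0 < z i" for i j
    using pos[OF that(1,4)] that(3) by (auto simp: up_def down_def)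
  have sum_neg: "\<exists>l<length (levels n z). down i l \<and> \<not> up j l" if "i < n" "j < n" "z i + z j < 0" "z i < 0" for i j
    using neg[OF that(1,4)] that(3) by (auto simp: up_def down_def)
  show "0 < z i + z j \<longleftrightarrow> (\<exists>l<length (levels n z). up i l \<and> \<not> down j l \<or> up j l \<and> \<not> down i l)" (is "?L \<longleftrightarrow> ?R")
  proof
    assume ?L
    then have "0 < z i \<or> 0 < z j" by linarith
    then show ?R using sum_pos[of i j] sum_pos[of j i] ij \<open>?L\<close> by (metis add.commute)
  next
    assume ?R
    then show ?L by (auto simp: up_def down_def)
  qed
  show "z i + z j < 0 \<longleftrightarrow> (\<exists>l<length (levels n z). down i l \<and> \<not> up j l \<or> down j l \<and> \<not> up i l)" (is "?L \<longleftrightarrow> ?R")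
  proof
    assume ?L
    then have "z i < 0 \<or> z j < 0" by linarith
    then show ?R using sum_neg[of i j] sum_neg[of j i] ij \<open>?L\<close> by (metis add.commute)
  next
    assume ?R
    then show ?L by (auto simp: up_def down_def)
  qed
  show "z j < z i \<longleftrightarrow> (\<exists>l<length (levels n z). up i l \<and> \<not> up j l \<or> down j l \<and> \<not> down i l)" (is "?L \<longleftrightarrow> ?R")
  proof
    assume L: ?L
    show ?R
    proof (cases "0 < z i")
      case True
      then show ?thesis using pos[OF ij(1)] L by (force simp: up_def)
    next
      case False
      then have "z j < 0" using L by simp
      then show ?thesis using neg[OF ij(2)] L by (force simp: down_def)
    qed
  next
    assume ?R
    then show ?L by (auto simp: up_def down_def)
  qed
qed

lemma sgn_eq_iff_less: "sgn a = sgn b \<longleftrightarrow> (0 < a \<longleftrightarrow> 0 < b) \<and> (a < 0 \<longleftrightarrow> b < 0)" for a b :: real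
  by (auto simp: sgn_if)

lemma signs_if_word_eq:
  assumes z: "z \<in> weyl_chamber_sl n" and z': "z' \<in> weyl_chamber_sl n" and eq: "level_word n z = level_word n z'"
    and ij: "i < n" "j < n"
  shows "sgn (z i + z j) = sgn (z' i + z' j)" "sgn (z i - z j) = sgn (z' i - z' j)"
proof -
  have len: "length (levels n z) = length (levels n z')" using eq by (metis length_level_word)
  have up: "levels n z ! l \<le> z k \<longleftrightarrow> levels n z' ! l \<le> z' k"
    and down: "z k \<le> - levels n z ! l \<longleftrightarrow> z' k \<le> - levels n z' ! l"
    if "k < n" "l < length (levels n z)" for k l
    using level_le_iff[OF z that] level_le_iff[OF z', of k l] le_uminus_level_iff[OF z that]
      le_uminus_level_iff[OF z', of k l] that len eq by simp_all
  show "sgn (z i + z j) = sgn (z' i + z' j)"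
    unfolding sgn_eq_iff_less signs_of_levels[OF ij] len[symmetric]
    using up[OF ij(1)] up[OF ij(2)] down[OF ij(1)] down[OF ij(2)] by blast
  have "z j < z i \<longleftrightarrow> z' j < z' i" "z i < z j \<longleftrightarrow> z' i < z' j"
    unfolding signs_of_levels(3)[OF ij] signs_of_levels(3)[OF ij(2,1)] len[symmetric]
    using up[OF ij(1)] up[OF ij(2)] down[OF ij(1)] down[OF ij(2)] by blast+
  then show "sgn (z i - z j) = sgn (z' i - z' j)"
    unfolding sgn_eq_iff_less by simp
qed

theorem closed_cell_eq_iff_word:
  assumes "z \<in> weyl_chamber_sl n" "z' \<in> weyl_chamber_sl n"
  shows "sl.closed_cell n z = sl.closed_cell n z' \<longleftrightarrow> level_word n z = level_word n z'"
proof
  assume "sl.closed_cell n z = sl.closed_cell n z'"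
  then have "same_order n z z'"
    using assms closed_cell_sl_eq_iff[of z n z'] by (intro same_order_if_signs) (auto dest: weyl_cartan)
  then show "level_word n z = level_word n z'" by (rule word_eq_if_same_order)
next
  assume "level_word n z = level_word n z'"
  then show "sl.closed_cell n z = sl.closed_cell n z'"
    using assms signs_if_word_eq[OF assms] closed_cell_sl_eq_iff[of z n z'] by (simp add: weyl_cartan)
qed

section \<open>Heights of words\<close>

text \<open>
  A letter \<open>(p, q)\<close> is a step that goes up by \<open>p\<close> and down by \<open>q\<close>; the partial sums of these steps make a
  word a walk on the integers.
\<close>

definition height :: "(nat \<times> nat) list \<Rightarrow> int" where
  "height w = (\<Sum>(p, q)\<leftarrow>w. int p - int q)"

definition size_of :: "(nat \<times> nat) list \<Rightarrow> nat" where
  "size_of w = (\<Sum>(p, q)\<leftarrow>w. p + q)"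

text \<open>
  The starting point \<open>h\<close> is among the heights that are tested. This makes the condition on the remaining word
  the same predicate with another start.
\<close>

definition stays_in :: "int set \<Rightarrow> int \<Rightarrow> (nat \<times> nat) list \<Rightarrow> bool" where
  "stays_in A h w \<longleftrightarrow> (\<forall>j\<le>length w. h + height (take j w) \<in> A)"

text \<open>
  The size is only bounded by \<open>n\<close>, which accounts for the vanishing coordinates of a point.
\<close>

definition walks :: "int set \<Rightarrow> int \<Rightarrow> nat \<Rightarrow> nat \<Rightarrow> (nat \<times> nat) list set" where
  "walks A h n m = {w. length w = m \<and> (0, 0) \<notin> set w \<and> size_of w \<le> n \<and> stays_in A h w}"

definition mixed_walks :: "nat \<Rightarrow> nat \<Rightarrow> (nat \<times> nat) list set" where
  "mixed_walks n m = walks UNIV 0 n m - walks {0..} 0 n m - walks {..0} 0 n m"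

lemma height_simps [simp]: "height [] = 0" "height ((p, q) # w) = int p - int q + height w"
  by (simp_all add: height_def)

lemma size_of_simps [simp]: "size_of [] = 0" "size_of ((p, q) # w) = p + q + size_of w"
  by (simp_all add: size_of_def)

lemma stays_in_Nil [simp]: "stays_in A h [] \<longleftrightarrow> h \<in> A"
  by (simp add: stays_in_def)

lemma stays_in_Cons [simp]:
  "stays_in A h ((p, q) # w) \<longleftrightarrow> h \<in> A \<and> stays_in A (h + int p - int q) w"
proof -
  have "(\<forall>j\<le>Suc k. Q j) \<longleftrightarrow> Q 0 \<and> (\<forall>j\<le>k. Q (Suc j))" for Q and k :: nat
    by (metis Suc_le_mono le0 not0_implies_Suc)
  then show ?thesis by (simp add: stays_in_def algebra_simps)
qed

lemma length_le_size_of: "(0, 0) \<notin> set w \<Longrightarrow> length w \<le> size_of w"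
proof (induction w)
  case (Cons a w)
  then show ?case by (cases a) (auto simp: Suc_le_eq)
qed simp

lemma finite_walks: "finite (walks A h n m)"
proof -
  have mem: "set w \<subseteq> {..size_of w} \<times> {..size_of w}" for w
  proof (induction w)
    case (Cons a w)
    obtain p q where "a = (p, q)" by (cases a)
    moreover have "{..size_of w} \<times> {..size_of w} \<subseteq> {..size_of (a # w)} \<times> {..size_of (a # w)}"
      using \<open>a = (p, q)\<close> by (intro Sigma_mono) auto
    ultimately show ?case using Cons by (auto simp: subset_iff intro: trans_le_add2)
  qed simp
  have "walks A h n m \<subseteq> {w. set w \<subseteq> {..n} \<times> {..n} \<and> length w = m}"
  proof
    fix w assume "w \<in> walks A h n m"
    then show "w \<in> {w. set w \<subseteq> {..n} \<times> {..n} \<and> length w = m}"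
      using mem[of w] by (fastforce simp: walks_def)
  qed
  then show ?thesis by (rule finite_subset) (simp add: finite_lists_length_eq)
qed

lemma stays_in_zero_iff: "stays_in {0} 0 w \<longleftrightarrow> (\<forall>(p, q)\<in>set w. p = q)"
proof (induction w)
  case (Cons a w)
  obtain p q where a: "a = (p, q)" by (cases a)
  have head: "stays_in {0} h w \<Longrightarrow> h = 0" for h by (cases w) auto
  show ?case using Cons head[of "int p - int q"] by (auto simp: a)
qed simp

definition drift :: "(nat \<times> nat) list \<Rightarrow> nat \<Rightarrow> int" where
  "drift w j = int (fst (w ! j)) - int (snd (w ! j))"

lemma height_take: "j \<le> length w \<Longrightarrow> height (take j w) = (\<Sum>l<j. drift w l)"
proof (induction j)
  case (Suc j)
  have "height (u @ v) = height u + height v" for u v by (simp add: height_def)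
  then show ?case using Suc by (simp add: take_Suc_conv_app_nth drift_def height_def case_prod_beta)
qed simp

lemma size_of_sum: "size_of w = (\<Sum>l<length w. fst (w ! l) + snd (w ! l))"
  by (simp add: size_of_def case_prod_beta sum_list_sum_nth atLeast0LessThan)

lemma stays_in_iff_drift: "stays_in A 0 w \<longleftrightarrow> 0 \<in> A \<and> (\<forall>l<length w. (\<Sum>k<Suc l. drift w k) \<in> A)"
proof -
  have "(\<forall>j\<le>m. Q j) \<longleftrightarrow> Q 0 \<and> (\<forall>l<m. Q (Suc l))" for Q and m :: nat
    by (metis Suc_le_eq le0 not0_implies_Suc)
  then show ?thesis unfolding stays_in_def by (auto simp: height_take Suc_le_eq simp del: sum.lessThan_Suc)
qed

section \<open>The words that occur on the space of trace zero\<close>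

lemma sum_levels: "(\<Sum>v\<in>abs_values n z. f v) = (\<Sum>j<length (levels n z). f (levels n z ! j))"
  using sum.reindex_bij_betw[OF bij_betw_nth[where xs = "levels n z", OF distinct_levels refl refl], where g = f] by simp

text \<open>
  With \<open>g\<close> the identity this expresses the trace by the word and the levels, with \<open>g\<close> constant the number of
  nonzero coordinates.
\<close>

lemma sum_by_values:
  fixes g :: "real \<Rightarrow> real"
  shows "(\<Sum>i | i < n \<and> z i \<noteq> 0. g (z i))
    = (\<Sum>v\<in>abs_values n z. real (fibre_card n z v) * g v + real (fibre_card n z (- v)) * g (- v))"
proof -
  let ?I = "{i. i < n \<and> z i \<noteq> 0}"
  have "(\<Sum>i\<in>?I. g (z i)) = (\<Sum>v\<in>abs_values n z. \<Sum>i\<in>{i \<in> ?I. \<bar>z i\<bar> = v}. g (z i))"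
    by (rule sum.group[symmetric]) (auto simp: abs_values_def)
  also have "\<dots> = (\<Sum>v\<in>abs_values n z. real (fibre_card n z v) * g v + real (fibre_card n z (- v)) * g (- v))"
  proof (rule sum.cong[OF refl])
    fix v assume "v \<in> abs_values n z"
    then have v: "0 < v" by (rule abs_values_pos)
    have "{i \<in> ?I. \<bar>z i\<bar> = v} = {i. i < n \<and> z i = v} \<union> {i. i < n \<and> z i = - v}" using v by auto
    moreover have "{i. i < n \<and> z i = v} \<inter> {i. i < n \<and> z i = - v} = {}" using v by auto
    ultimately show "(\<Sum>i\<in>{i \<in> ?I. \<bar>z i\<bar> = v}. g (z i)) = real (fibre_card n z v) * g v + real (fibre_card n z (- v)) * g (- v)"
      by (simp add: sum.union_disjoint fibre_card_def)
  qed
  finally show ?thesis .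
qed

lemma sum_coordinates: "(\<Sum>i<n. z i) = (\<Sum>j<length (levels n z). levels n z ! j * drift (level_word n z) j)"
proof -
  have "(\<Sum>i<n. z i) = (\<Sum>i | i < n \<and> z i \<noteq> 0. z i)"
    by (rule sum.mono_neutral_right) auto
  then show ?thesis
    unfolding sum_by_values[where g = "\<lambda>x. x"] sum_levels
    by (simp add: level_word_def drift_def algebra_simps)
qed

lemma size_level_word: "size_of (level_word n z) \<le> n"
proof -
  have "real (size_of (level_word n z)) = (\<Sum>v\<in>abs_values n z. real (fibre_card n z v) * 1 + real (fibre_card n z (- v)) * 1)"
    unfolding sum_levels size_of_sum by (simp add: level_word_def)
  also have "\<dots> = real (card {i. i < n \<and> z i \<noteq> 0})"
    by (subst sum_by_values[symmetric]) simp
  also have "card {i. i < n \<and> z i \<noteq> 0} \<le> card {..<n}" by (intro card_mono) auto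
  finally show ?thesis by simp
qed

lemma level_word_nonzero: "(0, 0) \<notin> set (level_word n z)"
proof
  assume "(0, 0) \<in> set (level_word n z)"
  then obtain v where v: "v \<in> abs_values n z" "fibre_card n z v = 0" "fibre_card n z (- v) = 0"
    by (auto simp: level_word_def)
  have "finite {k. k < n \<and> z k = r}" for r by simp
  then have none: "k < n \<Longrightarrow> z k \<noteq> v" "k < n \<Longrightarrow> z k \<noteq> - v" for k
    using v(2,3) unfolding fibre_card_def card_eq_0_iff by blast+
  obtain i where "i < n" "v = \<bar>z i\<bar>" using v(1) unfolding abs_values_def by blast
  then show False using none[of i] by (simp add: abs_if split: if_splits)
qed

lemma abel_summation:
  fixes v :: "nat \<Rightarrow> real"
  shows "(\<Sum>l<m. v l * d l) = (\<Sum>l<m. (v l - v (Suc l)) * (\<Sum>k<Suc l. d k)) + v m * (\<Sum>k<m. d k)"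
  by (induction m) (simp_all add: algebra_simps)

text \<open>
  If the heights have a weak sign, a vanishing combination of them with positive coefficients forces each of them
  to vanish.
\<close>

lemma trace_zero_type:
  assumes t: "\<And>l. l < length w \<Longrightarrow> 0 < t l"
    and zero: "(\<Sum>l<length w. t l * real_of_int (\<Sum>k<Suc l. drift w k)) = 0"
  shows "stays_in {0} 0 w \<or> \<not> stays_in {0..} 0 w \<and> \<not> stays_in {..0} 0 w"
proof -
  define D where "D l = real_of_int (\<Sum>k<Suc l. drift w k)" for l
  have *: "stays_in A 0 w \<longleftrightarrow> 0 \<in> A \<and> (\<forall>l<length w. (\<Sum>k<Suc l. drift w k) \<in> A)" for A
    by (rule stays_in_iff_drift)
  have zeroD: "(\<Sum>l<length w. t l * D l) = 0" using zero by (simp only: D_def)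
  have all_zero: "stays_in {0} 0 w" if "\<And>l. l < length w \<Longrightarrow> t l * D l = 0"
  proof -
    have "(\<Sum>k<Suc l. drift w k) = 0" if "l < length w" for l
      using \<open>\<And>l. l < length w \<Longrightarrow> t l * D l = 0\<close>[OF that] t[OF that]
      by (simp add: D_def del: sum.lessThan_Suc of_int_sum)
    then show ?thesis unfolding * by blast
  qed
  show ?thesis
  proof (cases "stays_in {0..} 0 w")
    case True
    then have "0 \<le> t l * D l" if "l < length w" for l
      using t[OF that] that unfolding * D_def by (simp del: sum.lessThan_Suc of_int_sum)
    then have "t l * D l = 0" if "l < length w" for l
      using sum_nonneg_eq_0_iff[of "{..<length w}" "\<lambda>l. t l * D l"] zeroD that by simp
    then show ?thesis using all_zero by blast
  next
    case False
    show ?thesis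
    proof (cases "stays_in {..0} 0 w")
      case True
      then have "t l * D l \<le> 0" if "l < length w" for l
        using t[OF that] that unfolding * D_def by (simp add: mult_nonneg_nonpos del: sum.lessThan_Suc of_int_sum)
      then have "t l * D l = 0" if "l < length w" for l
        using sum_nonneg_eq_0_iff[of "{..<length w}" "\<lambda>l. - (t l * D l)"] zeroD that
        by (simp add: sum_negf)
      then show ?thesis using all_zero by blast
    qed (use False in blast)
  qed
qed

text \<open>
  If heights of both signs occur, the positive ones can be weighted by the total of the negative ones and vice
  versa.
\<close>

lemma exists_balancing_gaps:
  assumes "stays_in {0} 0 w \<or> \<not> stays_in {0..} 0 w \<and> \<not> stays_in {..0} 0 w"
  obtains t where "\<And>l. l < length w \<Longrightarrow> 0 < t l"
    "(\<Sum>l<length w. t l * real_of_int (\<Sum>k<Suc l. drift w k)) = 0"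
proof -
  define D where "D l = real_of_int (\<Sum>k<Suc l. drift w k)" for l
  have *: "stays_in A 0 w \<longleftrightarrow> 0 \<in> A \<and> (\<forall>l<length w. (\<Sum>k<Suc l. drift w k) \<in> A)" for A
    by (rule stays_in_iff_drift)
  have "\<exists>t. (\<forall>l<length w. 0 < t l) \<and> (\<Sum>l<length w. t l * D l) = 0"
    using assms
  proof
    assume "stays_in {0} 0 w"
    then have "D l = 0" if "l < length w" for l using that unfolding * D_def by simp
    then show ?thesis by (intro exI[of _ "\<lambda>_. 1"]) simp
  next
    assume mixed: "\<not> stays_in {0..} 0 w \<and> \<not> stays_in {..0} 0 w"
    define p where "p = (\<Sum>l<length w. max 0 (D l))"
    define q where "q = (\<Sum>l<length w. max 0 (- D l))"
    obtain i j where ij: "i < length w" "j < length w" "D i < 0" "0 < D j"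
      using mixed unfolding * D_def by (auto simp: not_le simp del: sum.lessThan_Suc of_int_sum)
    have "0 < p" unfolding p_def by (rule sum_pos2[of _ j]) (use ij in auto)
    have "0 < q" unfolding q_def by (rule sum_pos2[of _ i]) (use ij in auto)
    \<comment> \<open>the value at zero heights is arbitrary but has to be positive\<close>
    define t where "t l = (if 0 < D l then q else if D l < 0 then p else 1)" for l
    have "t l * D l = q * max 0 (D l) - p * max 0 (- D l)" for l by (simp add: t_def)
    then have "(\<Sum>l<length w. t l * D l) = q * p - p * q"
      by (simp add: sum_subtractf p_def q_def flip: sum_distrib_left)
    then show ?thesis using \<open>0 < p\<close> \<open>0 < q\<close> by (intro exI[of _ t]) (simp add: t_def)
  qed
  then show ?thesis using that unfolding D_def by blast
qed

lemma level_word_type: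
  assumes z: "z \<in> weyl_chamber_sl n"
  shows "stays_in {0} 0 (level_word n z) \<or> \<not> stays_in {0..} 0 (level_word n z) \<and> \<not> stays_in {..0} 0 (level_word n z)"
proof (rule trace_zero_type)
  let ?L = "levels n z"
  \<comment> \<open>the value \<open>0\<close> after the last level makes the boundary term of the Abel summation vanish\<close>
  define v where "v l = (if l < length ?L then ?L ! l else 0)" for l
  have "0 = (\<Sum>i<n. z i)" using weyl_cartan[OF z] by (simp add: cartan_sl_eq)
  also have "\<dots> = (\<Sum>l<length ?L. v l * drift (level_word n z) l)"
    unfolding sum_coordinates[where z = z and n = n] by (simp add: v_def)
  also have "\<dots> = (\<Sum>l<length ?L. (v l - v (Suc l)) * (\<Sum>k<Suc l. drift (level_word n z) k))"
    using abel_summation[where v = v and d = "\<lambda>l. real_of_int (drift (level_word n z) l)" and m = "length ?L"]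
    by (simp add: v_def del: sum.lessThan_Suc)
  finally show "(\<Sum>l<length (level_word n z). (v l - v (Suc l)) * real_of_int (\<Sum>k<Suc l. drift (level_word n z) k)) = 0"
    by simp
  show "0 < v l - v (Suc l)" if "l < length (level_word n z)" for l
    using that levels_nth_pos[of l n z] sorted_wrt_nth_less[OF levels_decreasing[of n z], of l "Suc l"]
    by (auto simp: v_def)
qed

text \<open>
  Take the prescribed values with the prescribed multiplicities, fill up with zeros, and sort.
\<close>

lemma realize_word:
  assumes nonzero: "(0, 0) \<notin> set w" and size: "size_of w \<le> n" and len: "length vs = length w"
    and dec: "sorted_wrt (>) vs" and pos: "\<And>v. v \<in> set vs \<Longrightarrow> 0 < v"
    and trace: "(\<Sum>j<length w. vs ! j * real_of_int (drift w j)) = 0"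
  obtains z where "z \<in> weyl_chamber_sl n" "level_word n z = w"
proof -
  define M where "M = (\<Sum>j<length w. replicate_mset (fst (w ! j)) (vs ! j) + replicate_mset (snd (w ! j)) (- vs ! j))
    + replicate_mset (n - size_of w) 0"
  define xs where "xs = rev (sorted_list_of_multiset M)"
  define z where "z i = (if i < n then xs ! i else 0)" for i
  have "size M = n"
    using size by (simp add: M_def size_multiset_sum size_of_sum)
  then have lxs: "length xs = n" by (simp add: xs_def flip: size_mset)
  have "mset xs = M" by (simp add: xs_def)
  have count: "fibre_card n z r = count M r" for r
  proof -
    have "count (mset xs) r = card {i. i < n \<and> xs ! i = r}"
      by (simp add: count_mset count_list_eq_length_filter length_filter_conv_card lxs eq_commute)
    moreover have "{i. i < n \<and> z i = r} = {i. i < n \<and> xs ! i = r}" by (auto simp: z_def)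
    ultimately show ?thesis using \<open>mset xs = M\<close> by (simp add: fibre_card_def)
  qed
  have vpos: "0 < vs ! j" if "j < length w" for j using that pos len by simp
  have dist: "distinct vs" using dec by (metis distinct_rev sorted_wrt_rev strict_sorted_iff)
  have count_level: "count M (vs ! j) = fst (w ! j)" "count M (- (vs ! j)) = snd (w ! j)" if j: "j < length w" for j
  proof -
    have ne: "- (vs ! l) \<noteq> vs ! j" "vs ! l \<noteq> - (vs ! j)" if "l < length w" for l
      using vpos[OF that] vpos[OF j] by linarith+
    have eq: "vs ! l = vs ! j \<longleftrightarrow> l = j" if "l < length w" for l
      using nth_eq_iff_index_eq[OF dist] that j len by simp
    have "count M (vs ! j) = (\<Sum>l<length w. (if vs ! j = vs ! l then fst (w ! l) else 0)
        + (if vs ! j = - (vs ! l) then snd (w ! l) else 0))"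
      unfolding M_def using vpos[OF j] by (simp add: count_sum)
    also have "\<dots> = (\<Sum>l<length w. if l = j then fst (w ! l) else 0)"
      by (rule sum.cong[OF refl]) (use ne eq in force)
    finally show "count M (vs ! j) = fst (w ! j)" using j by simp
    have "count M (- (vs ! j)) = (\<Sum>l<length w. (if - (vs ! j) = vs ! l then fst (w ! l) else 0)
        + (if vs ! j = vs ! l then snd (w ! l) else 0))"
      unfolding M_def using vpos[OF j] by (simp add: count_sum)
    also have "\<dots> = (\<Sum>l<length w. if l = j then snd (w ! l) else 0)"
      by (rule sum.cong[OF refl]) (use ne eq in force)
    finally show "count M (- (vs ! j)) = snd (w ! j)" using j by simp
  qed
  have "levels n z = vs"
  proof (rule levels_eqI[OF dec], rule set_eqI)
    fix r
    have mult_pos: "0 < fibre_card n z r \<longleftrightarrow> (\<exists>i<n. z i = r)" for r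
      unfolding fibre_card_def by (subst card_gt_0_iff) auto
    show "r \<in> set vs \<longleftrightarrow> r \<in> abs_values n z"
    proof
      assume "r \<in> set vs"
      then obtain j where j: "j < length w" "r = vs ! j" using len by (metis in_set_conv_nth)
      have "w ! j \<noteq> (0, 0)" using nonzero j(1) by (metis nth_mem)
      then have "0 < fibre_card n z r \<or> 0 < fibre_card n z (- r)"
        using count_level[OF j(1)] j(2) by (auto simp: count prod_eq_iff)
      then obtain i where "i < n" "z i = r \<or> z i = - r" using mult_pos by blast
      then have "i < n" "r = \<bar>z i\<bar>" "r \<noteq> 0" using vpos[OF j(1)] j(2) by auto
      then show "r \<in> abs_values n z" unfolding abs_values_def by blast
    next
      assume "r \<in> abs_values n z"
      then obtain i where i: "i < n" "r = \<bar>z i\<bar>" "z i \<noteq> 0" by (auto simp: abs_values_def)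
      then have "0 < count M (z i)" using mult_pos[of "z i"] by (auto simp: count)
      then have "z i \<in># M" by simp
      then obtain j where "j < length w" "z i = vs ! j \<or> z i = - (vs ! j)"
        using i(3) by (auto simp: M_def set_mset_sum split: if_splits)
      then show "r \<in> set vs" using i(2) vpos len by (metis abs_minus_cancel abs_of_pos nth_mem)
    qed
  qed
  moreover have "map (\<lambda>v. (fibre_card n z v, fibre_card n z (- v))) vs = w"
    by (rule nth_equalityI) (use len count_level in \<open>auto simp: count\<close>)
  ultimately have word: "level_word n z = w" by (simp add: level_word_def)
  have "z \<in> cartan_sl n"
    using trace sum_coordinates[where z = z and n = n] len unfolding word \<open>levels n z = vs\<close>
    by (simp add: cartan_sl_eq z_def)
  moreover have "z (Suc i) \<le> z i" if "Suc i < n" for i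
  proof -
    have "sorted_wrt (\<ge>) xs" unfolding xs_def sorted_wrt_rev using sorted_sorted_list_of_multiset by simp
    then show ?thesis using that lxs by (simp add: z_def sorted_wrt_iff_nth_less)
  qed
  ultimately have "z \<in> weyl_chamber_sl n" by (simp add: weyl_chamber_sl_def)
  then show ?thesis using that word by blast
qed

theorem words_of_chamber:
  "level_word n ` weyl_chamber_sl n = {w. (0, 0) \<notin> set w \<and> size_of w \<le> n \<and>
     (stays_in {0} 0 w \<or> \<not> stays_in {0..} 0 w \<and> \<not> stays_in {..0} 0 w)}" (is "?L = ?R")
proof
  show "?L \<subseteq> ?R" using level_word_type size_level_word level_word_nonzero by blast
  show "?R \<subseteq> ?L"
  proof
    fix w assume w: "w \<in> ?R"
    then obtain t where t: "\<And>l. l < length w \<Longrightarrow> 0 < t l"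
      "(\<Sum>l<length w. t l * real_of_int (\<Sum>k<Suc l. drift w k)) = 0"
      using exists_balancing_gaps by blast
    define v where "v j = sum t {j..<length w}" for j
    have step: "v j = t j + v (Suc j)" if "j < length w" for j
      using that by (simp add: v_def sum.atLeast_Suc_lessThan)
    have pos: "0 < v j" if "j < length w" for j
      unfolding v_def using t(1) that by (intro sum_pos) auto
    have less: "v k < v j" if "j < k" "k < length w" for j k
    proof -
      have "v j = sum t {j..<k} + v k"
        unfolding v_def using that by (simp add: sum.atLeastLessThan_concat)
      moreover have "0 < sum t {j..<k}" using t(1) that by (intro sum_pos) auto
      ultimately show ?thesis by simp
    qed
    have "(\<Sum>j<length w. v j * real_of_int (drift w j)) = (\<Sum>l<length w. (v l - v (Suc l)) * (\<Sum>k<Suc l. real_of_int (drift w k)))"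
      using abel_summation[where v = v and d = "\<lambda>l. real_of_int (drift w l)" and m = "length w"]
      by (simp add: v_def del: sum.lessThan_Suc)
    also have "\<dots> = (\<Sum>l<length w. t l * real_of_int (\<Sum>k<Suc l. drift w k))"
      by (intro sum.cong) (auto simp: step)
    finally have trace: "(\<Sum>j<length w. v j * real_of_int (drift w j)) = 0" using t(2) by simp
    obtain z where "z \<in> weyl_chamber_sl n" "level_word n z = w"
    proof (rule realize_word)
      show "(0, 0) \<notin> set w" "size_of w \<le> n" using w by auto
      show "length (map v [0..<length w]) = length w" by simp
      show "sorted_wrt (>) (map v [0..<length w])"
        by (simp add: sorted_wrt_iff_nth_less less)
      show "0 < r" if "r \<in> set (map v [0..<length w])" for r using that pos by auto
      show "(\<Sum>j<length w. map v [0..<length w] ! j * real_of_int (drift w j)) = 0" using trace by simp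
    qed
    then show "w \<in> ?L" by blast
  qed
qed

section \<open>Dimensions of faces\<close>

text \<open>
  A nonzero linear form lowers the dimension by one: a basis of its kernel is completed by a single vector.
\<close>

lemma dim_hyperplane:
  fixes S :: "('i \<Rightarrow> real) set"
  assumes S: "subspace S" "S \<subseteq> span B" "finite B"
    and phi: "linear \<phi>" and u: "u \<in> S" "\<phi> u \<noteq> (0 :: real)"
  shows "dim S = Suc (dim {y \<in> S. \<phi> y = 0})"
proof -
  let ?K = "{y \<in> S. \<phi> y = 0}"
  obtain C where C: "C \<subseteq> ?K" "independent C" "?K \<subseteq> span C" "card C = dim ?K"
    by (rule basis_exists)
  have sub: "subspace ?K"
    using S(1) phi by (auto simp: subspace_def linear_0 linear_add linear_scale)
  then have "span C \<subseteq> ?K" using C(1) by (rule span_minimal[rotated])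
  then have nin: "u \<notin> span C" using u(2) by auto
  have "C \<subseteq> span B" using C(1) S(2) by auto
  then have "finite C" using independent_span_bound[OF S(3) C(2)] by simp
  have "S \<subseteq> span (insert u C)"
  proof
    fix y assume y: "y \<in> S"
    have "y - (\<phi> y / \<phi> u) *\<^sub>R u \<in> ?K"
      using y u S(1) phi by (simp add: subspace_diff subspace_scale linear_diff linear_scale)
    then have "y - (\<phi> y / \<phi> u) *\<^sub>R u \<in> span C" using C(3) by blast
    then show "y \<in> span (insert u C)" by (auto simp: span_insert)
  qed
  moreover have "independent (insert u C)" using C(2) nin by (rule independent_insertI[rotated])
  ultimately have "dim S = card (insert u C)"
    using C(1) u(1) by (intro dim_unique) auto
  then show ?thesis using \<open>finite C\<close> nin C(4) span_base by (metis card_insert_disjoint)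
qed

lemma sum_fun_apply: "(\<Sum>x\<in>S. g x) i = (\<Sum>x\<in>S. g x i)" for g :: "'b \<Rightarrow> 'i \<Rightarrow> real"
  by (induction S rule: infinite_finite_induct) simp_all

text \<open>
  The span of the cell of \<open>z\<close> in \<open>\<real>\<^sup>n\<close>, before the condition on the trace is imposed.
\<close>

definition level_space :: "nat \<Rightarrow> (nat \<Rightarrow> real) \<Rightarrow> (nat \<Rightarrow> real) set" where
  "level_space n z = {y. (\<forall>i\<ge>n. y i = 0) \<and>
     (\<forall>i<n. \<forall>j<n. (z i = z j \<longrightarrow> y i = y j) \<and> (z i = - z j \<longrightarrow> y i = - y j))}"

text \<open>
  These vectors form a basis of the space above: one for each level of \<open>z\<close>.
\<close>

definition level_vector :: "nat \<Rightarrow> (nat \<Rightarrow> real) \<Rightarrow> real \<Rightarrow> nat \<Rightarrow> real" where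
  "level_vector n z v = (\<lambda>i. if i < n \<and> \<bar>z i\<bar> = v then sgn (z i) else 0)"

lemma level_spaceD:
  assumes "y \<in> level_space n z"
  shows "n \<le> i \<Longrightarrow> y i = 0"
    and "i < n \<Longrightarrow> j < n \<Longrightarrow> z i = z j \<Longrightarrow> y i = y j"
    and "i < n \<Longrightarrow> j < n \<Longrightarrow> z i = - z j \<Longrightarrow> y i = - y j"
  using assms unfolding level_space_def by blast+

lemma level_spaceI:
  assumes "\<And>i. n \<le> i \<Longrightarrow> y i = 0"
    and "\<And>i j. i < n \<Longrightarrow> j < n \<Longrightarrow> z i = z j \<Longrightarrow> y i = y j"
    and "\<And>i j. i < n \<Longrightarrow> j < n \<Longrightarrow> z i = - z j \<Longrightarrow> y i = - y j"
  shows "y \<in> level_space n z"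
  using assms unfolding level_space_def by blast

lemma span_closed_cell_sl:
  assumes z: "z \<in> weyl_chamber_sl n"
  shows "span (sl.closed_cell n z) = {y \<in> level_space n z. (\<Sum>i<n. y i) = 0}"
proof -
  have "(\<forall>f\<in>walls n \<union> nonzero_weights n. f z = 0 \<longrightarrow> f y = 0) \<longleftrightarrow>
      (\<forall>i<n. \<forall>j<n. (z i = z j \<longrightarrow> y i = y j) \<and> (z i = - z j \<longrightarrow> y i = - y j))" (is "?A \<longleftrightarrow> ?B")
    if y: "y \<in> cartan_sl n" for y
  proof -
    have A: "?A \<longleftrightarrow> (\<forall>i. Suc i < n \<longrightarrow> z i - z (Suc i) = 0 \<longrightarrow> y i - y (Suc i) = 0) \<and>
        (\<forall>i<n. z i = 0 \<longrightarrow> y i = 0) \<and> (\<forall>i j. i < j \<and> j < n \<longrightarrow> z i + z j = 0 \<longrightarrow> y i + y j = 0)"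
      by (rule ball_walls_weights) (use weights_nonzero_weights[OF _ _ y] in blast)
    show ?thesis
    proof
      assume ?A
      note A' = this[unfolded A]
      have eq: "y i = y j" if "i < n" "j < n" "z i = z j" for i j
        by (rule equal_coordinates[OF z _ that]) (use A' in simp)
      have "y i = - y j" if ij: "i < n" "j < n" "z i = - z j" for i j
      proof (cases i j rule: linorder_cases)
        case less
        then have "y i + y j = 0" using A' ij by simp
        then show ?thesis by simp
      next
        case equal
        then have "y i = 0" using A' ij by simp
        then show ?thesis using equal by simp
      next
        case greater
        then have "y j + y i = 0" using A' ij by simp
        then show ?thesis by simp
      qed
      then show ?B using eq by blast
    next
      assume B: ?B
      have "y i - y (Suc i) = 0" if "Suc i < n" "z i - z (Suc i) = 0" for i
        using B[rule_format, of i "Suc i"] that by simp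
      moreover have "y i = 0" if "i < n" "z i = 0" for i
        using B[rule_format, of i i] that by simp
      moreover have "y i + y j = 0" if "i < j" "j < n" "z i + z j = 0" for i j
        using B[rule_format, of i j] that by simp
      ultimately show ?A unfolding A by blast
    qed
  qed
  then have "y \<in> cartan_sl n \<and> (\<forall>f\<in>walls n \<union> nonzero_weights n. f z = 0 \<longrightarrow> f y = 0) \<longleftrightarrow>
      y \<in> level_space n z \<and> (\<Sum>i<n. y i) = 0" for y
    unfolding cartan_sl_eq level_space_def by blast
  then show ?thesis
    unfolding sl.span_closed_cell[OF weyl_cartan[OF z]] by blast
qed

lemma subspace_level_space: "subspace (level_space n z)"
proof (rule subspaceI)
  show "0 \<in> level_space n z" by (rule level_spaceI) simp_all
  show "x + y \<in> level_space n z" if xy: "x \<in> level_space n z" "y \<in> level_space n z" for x y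
  proof (rule level_spaceI)
    show "(x + y) i = 0" if "n \<le> i" for i
      using level_spaceD(1)[OF xy(1) that] level_spaceD(1)[OF xy(2) that] by simp
    show "(x + y) i = (x + y) j" if "i < n" "j < n" "z i = z j" for i j
      using level_spaceD(2)[OF xy(1) that] level_spaceD(2)[OF xy(2) that] by simp
    show "(x + y) i = - (x + y) j" if "i < n" "j < n" "z i = - z j" for i j
      using level_spaceD(3)[OF xy(1) that] level_spaceD(3)[OF xy(2) that] by simp
  qed
  show "c *\<^sub>R x \<in> level_space n z" if x: "x \<in> level_space n z" for c x
  proof (rule level_spaceI)
    show "(c *\<^sub>R x) i = 0" if "n \<le> i" for i using level_spaceD(1)[OF x that] by simp
    show "(c *\<^sub>R x) i = (c *\<^sub>R x) j" if "i < n" "j < n" "z i = z j" for i j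
      using level_spaceD(2)[OF x that] by simp
    show "(c *\<^sub>R x) i = - (c *\<^sub>R x) j" if "i < n" "j < n" "z i = - z j" for i j
      using level_spaceD(3)[OF x that] by simp
  qed
qed

lemma sum_level_vectors_apply:
  "(\<Sum>v\<in>abs_values n z. c v *\<^sub>R level_vector n z v) i = (if i < n then c \<bar>z i\<bar> * sgn (z i) else 0)"
proof -
  have "(\<Sum>v\<in>abs_values n z. c v *\<^sub>R level_vector n z v) i
      = (\<Sum>v\<in>abs_values n z. if v = \<bar>z i\<bar> then if i < n then c \<bar>z i\<bar> * sgn (z i) else 0 else 0)"
    unfolding sum_fun_apply by (intro sum.cong) (auto simp: level_vector_def)
  also have "\<dots> = (if i < n then c \<bar>z i\<bar> * sgn (z i) else 0)"
    by (auto simp: abs_values_def)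
  finally show ?thesis .
qed

lemma level_vectors_basis:
  shows "inj_on (level_vector n z) (abs_values n z)"
    and "independent (level_vector n z ` abs_values n z)"
    and "level_vector n z ` abs_values n z \<subseteq> level_space n z"
    and "level_space n z \<subseteq> span (level_vector n z ` abs_values n z)"
proof -
  show inj: "inj_on (level_vector n z) (abs_values n z)"
  proof (rule inj_onI)
    fix v v' assume v: "v \<in> abs_values n z" "v' \<in> abs_values n z" "level_vector n z v = level_vector n z v'"
    then obtain i where i: "i < n" "v = \<bar>z i\<bar>" "z i \<noteq> 0" by (auto simp: abs_values_def)
    have "level_vector n z v' i \<noteq> 0" using i v(3) by (metis level_vector_def sgn_eq_0_iff)
    then show "v = v'" using i by (simp add: level_vector_def split: if_splits)
  qed
  show "independent (level_vector n z ` abs_values n z)"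
  proof
    assume "dependent (level_vector n z ` abs_values n z)"
    then obtain u where u: "\<exists>x\<in>level_vector n z ` abs_values n z. u x \<noteq> 0"
      "(\<Sum>x\<in>level_vector n z ` abs_values n z. u x *\<^sub>R x) = 0"
      using dependent_finite[of "level_vector n z ` abs_values n z"] by auto
    then obtain v where v: "v \<in> abs_values n z" "u (level_vector n z v) \<noteq> 0" by blast
    then obtain i where i: "i < n" "v = \<bar>z i\<bar>" "z i \<noteq> 0" by (auto simp: abs_values_def)
    have "(\<Sum>v\<in>abs_values n z. u (level_vector n z v) *\<^sub>R level_vector n z v) = 0"
      using u(2) inj by (simp add: sum.reindex)
    then have "u (level_vector n z \<bar>z i\<bar>) * sgn (z i) = 0"
      using sum_level_vectors_apply[where c = "\<lambda>v. u (level_vector n z v)" and n = n and z = z and i = i] i(1) by simp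
    then show False using v(2) i by (simp add: sgn_eq_0_iff)
  qed
  show "level_vector n z ` abs_values n z \<subseteq> level_space n z"
    by (auto simp: level_space_def level_vector_def)
  show "level_space n z \<subseteq> span (level_vector n z ` abs_values n z)"
  proof
    fix y assume y: "y \<in> level_space n z"
    define k where "k v = (SOME i. i < n \<and> \<bar>z i\<bar> = v)" for v
    define c where "c v = sgn (z (k v)) * y (k v)" for v
    have "y = (\<Sum>v\<in>abs_values n z. c v *\<^sub>R level_vector n z v)"
    proof
      fix i
      show "y i = (\<Sum>v\<in>abs_values n z. c v *\<^sub>R level_vector n z v) i"
      proof (cases "i < n")
        case True
        let ?k = "k \<bar>z i\<bar>"
        have k: "?k < n \<and> \<bar>z ?k\<bar> = \<bar>z i\<bar>"
          unfolding k_def by (rule someI[of _ i]) (use True in simp)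
        have yk: "z i = z ?k \<Longrightarrow> y i = y ?k" "z i = - z ?k \<Longrightarrow> y i = - y ?k" "z i = - z i \<Longrightarrow> y i = - y i"
          using y k True unfolding level_space_def by blast+
        consider "z i = z ?k" "z i \<noteq> 0" | "z i = - z ?k" "z i \<noteq> 0" | "z i = 0"
          using k by (auto simp: abs_if split: if_splits)
        then have "y i = c \<bar>z i\<bar> * sgn (z i)"
        proof cases
          case 1
          have "sgn (z ?k) * sgn (z ?k) = 1" using 1 by (simp add: sgn_if)
          then show ?thesis unfolding c_def using yk(1)[OF 1(1)] 1(1) by (simp add: mult.assoc mult.commute)
        next
          case 2
          have "sgn (z ?k) * sgn (z i) = - 1" using 2 by (auto simp: sgn_if)
          moreover have "c \<bar>z i\<bar> * sgn (z i) = (sgn (z ?k) * sgn (z i)) * y ?k" by (simp add: c_def mult_ac)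
          ultimately show ?thesis using yk(2)[OF 2(1)] by simp
        next
          case 3
          then show ?thesis using yk(3) by simp
        qed
        then show ?thesis using True by (simp add: sum_level_vectors_apply)
      next
        case False
        then show ?thesis using y unfolding sum_level_vectors_apply by (simp add: level_space_def)
      qed
    qed
    then show "y \<in> span (level_vector n z ` abs_values n z)"
      by (metis (no_types, lifting) image_eqI span_base span_scale span_sum)
  qed
qed

lemma sum_level_vector:
  assumes "v \<in> abs_values n z"
  shows "(\<Sum>i<n. level_vector n z v i) = real (fibre_card n z v) - real (fibre_card n z (- v))"
proof -
  have v: "0 < v" using assms by (rule abs_values_pos)
  have "level_vector n z v i = of_bool (z i = v) - of_bool (z i = - v)" if "i < n" for i
    using that v by (auto simp: level_vector_def)
  then have "(\<Sum>i<n. level_vector n z v i) = (\<Sum>i<n. of_bool (z i = v)) - (\<Sum>i<n. of_bool (z i = - v))"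
    by (simp add: sum_subtractf)
  moreover have "(\<Sum>i<n. of_bool (z i = r)) = real (fibre_card n z r)" for r
  proof -
    have "{..<n} \<inter> {i. z i = r} = {i. i < n \<and> z i = r}" by auto
    then show ?thesis by (simp add: fibre_card_def of_bool_def sum.If_cases)
  qed
  ultimately show ?thesis by simp
qed

text \<open>
  The space of all vectors with the equalities of \<open>z\<close> has one basis vector for each letter. On the one that
  belongs to the letter \<open>(p, q)\<close> the trace is \<open>p - q\<close>, hence the trace vanishes identically exactly if all heights
  do.
\<close>

theorem dim_closed_cell:
  assumes z: "z \<in> weyl_chamber_sl n"
  shows "dim (span (sl.closed_cell n z)) =
    (if stays_in {0} 0 (level_word n z) then length (level_word n z) else length (level_word n z) - 1)"
proof -
  define \<phi> where "\<phi> y = (\<Sum>i<n. y i)" for y :: "nat \<Rightarrow> real"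
  have lin: "linear \<phi>" unfolding \<phi>_def by (rule linearI) (simp_all add: sum.distrib sum_distrib_left)
  let ?B = "level_vector n z ` abs_values n z"
  have "card ?B = length (level_word n z)"
    using card_image[OF level_vectors_basis(1)] distinct_card[OF distinct_levels[of n z]] by simp
  then have dim: "dim (level_space n z) = length (level_word n z)"
    using level_vectors_basis[of n z] by (intro dim_unique)
  have balanced: "stays_in {0} 0 (level_word n z) \<longleftrightarrow> (\<forall>b\<in>?B. \<phi> b = 0)"
    by (simp add: stays_in_zero_iff level_word_def \<phi>_def sum_level_vector)
  have span: "span (sl.closed_cell n z) = {y \<in> level_space n z. \<phi> y = 0}"
    using span_closed_cell_sl[OF z] by (simp add: \<phi>_def)
  show ?thesis
  proof (cases "stays_in {0} 0 (level_word n z)")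
    case True
    have "subspace {y. \<phi> y = 0}" using lin by (simp add: subspace_def linear_0 linear_add linear_scale)
    then have "span ?B \<subseteq> {y. \<phi> y = 0}" using True balanced by (intro span_minimal) auto
    then have "{y \<in> level_space n z. \<phi> y = 0} = level_space n z" using level_vectors_basis(4)[of n z] by auto
    then show ?thesis using True dim unfolding span by simp
  next
    case False
    then obtain b where "b \<in> ?B" "\<phi> b \<noteq> 0" using balanced by blast
    then have "dim (level_space n z) = Suc (dim {y \<in> level_space n z. \<phi> y = 0})"
      using level_vectors_basis(3)[of n z]
      by (intro dim_hyperplane[OF subspace_level_space level_vectors_basis(4) _ lin]) auto
    then show ?thesis using False dim unfolding span by simp
  qed
qed

lemma card_image_cong_iff:
  assumes "\<And>x y. x \<in> S \<Longrightarrow> y \<in> S \<Longrightarrow> f x = f y \<longleftrightarrow> g x = g y"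
  shows "card (f ` S) = card (g ` S)"
proof (rule bij_betw_same_card)
  define h where "h a = g (SOME x. x \<in> S \<and> f x = a)" for a
  have h: "h (f x) = g x" if "x \<in> S" for x
  proof -
    have "(SOME y. y \<in> S \<and> f y = f x) \<in> S \<and> f (SOME y. y \<in> S \<and> f y = f x) = f x"
      by (rule someI[of _ x]) (use that in simp)
    then show ?thesis unfolding h_def using assms that by blast
  qed
  show "bij_betw h (f ` S) (g ` S)"
    by (rule bij_betw_imageI) (auto simp: inj_on_def h assms image_image)
qed

text \<open>
  A face of dimension \<open>k\<close> comes either from a word of length \<open>k\<close> with zero heights or from a word of length
  \<open>k + 1\<close> with heights of both signs.
\<close>

theorem num_faces_eq: "num_faces n k = card (walks {0} 0 n k) + card (mixed_walks n (Suc k))"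
proof -
  define d where "d w = (if stays_in {0} 0 w then length w else length w - 1)" for w :: "(nat \<times> nat) list"
  let ?S = "{z \<in> weyl_chamber_sl n. d (level_word n z) = k}"
  have "{F \<in> faces n. dim (span F) = k} = sl.closed_cell n ` ?S"
    using dim_closed_cell by (auto simp: faces_eq_closed_cells d_def)
  then have "num_faces n k = card (sl.closed_cell n ` ?S)" by (simp only: num_faces_def)
  also have "\<dots> = card (level_word n ` ?S)"
    by (rule card_image_cong_iff) (use closed_cell_eq_iff_word in blast)
  also have "level_word n ` ?S = {w \<in> level_word n ` weyl_chamber_sl n. d w = k}" by auto
  also have "\<dots> = walks {0} 0 n k \<union> mixed_walks n (Suc k)"
  proof (rule set_eqI)
    fix w
    have sub: "stays_in {0} 0 w \<Longrightarrow> stays_in A 0 w" if "0 \<in> A" for A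
      using that by (simp add: stays_in_def)
    have "w \<noteq> []" if "\<not> stays_in {0..} 0 w" using that by auto
    then have "\<not> stays_in {0..} 0 w \<Longrightarrow> length w - 1 = k \<longleftrightarrow> length w = Suc k"
      by (cases w) auto
    then show "w \<in> {w \<in> level_word n ` weyl_chamber_sl n. d w = k} \<longleftrightarrow> w \<in> walks {0} 0 n k \<union> mixed_walks n (Suc k)"
      using sub[of "{0..}"] sub[of "{..0}"]
      by (auto simp: words_of_chamber d_def walks_def mixed_walks_def stays_in_def[of UNIV])
  qed
  also have "card \<dots> = card (walks {0} 0 n k) + card (mixed_walks n (Suc k))"
  proof (rule card_Un_disjoint)
    show "finite (walks {0} 0 n k)" "finite (mixed_walks n (Suc k))"
      by (simp_all add: finite_walks mixed_walks_def)
    show "walks {0} 0 n k \<inter> mixed_walks n (Suc k) = {}" by (auto simp: walks_def mixed_walks_def)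
  qed
  finally show ?thesis .
qed

section \<open>Recurrences for the number of words\<close>

definition heading :: "nat \<Rightarrow> nat \<Rightarrow> (nat \<times> nat) list set" where
  "heading p q = {w. \<exists>a b v. w = (a, b) # v \<and> p \<le> a \<and> q \<le> b}"

lemma heading_cover: "walks A h n (Suc m) \<subseteq> heading 1 0 \<union> heading 0 1"
proof
  fix w assume "w \<in> walks A h n (Suc m)"
  moreover from this obtain a b v where "w = (a, b) # v"
    by (cases w) (auto simp: walks_def)
  ultimately show "w \<in> heading 1 0 \<union> heading 0 1" by (auto simp: heading_def walks_def)
qed

lemma heading_Int: "heading p q \<inter> heading p' q' = heading (max p p') (max q q')"
  by (auto simp: heading_def)

lemma walks_heading_empty:
  "n < p + q \<Longrightarrow> walks A h n m \<inter> heading p q = {}"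
  by (auto simp: walks_def heading_def)

text \<open>
  Removing \<open>(p, q)\<close> from the first letter moves the start by \<open>p - q\<close>. Either a nonzero letter remains and the
  length is unchanged, or the letter disappears and the word becomes shorter. Before and
  after the removal the same heights are tested, up to the two starting points, hence the assumptions on these.
\<close>

lemma card_walks_heading:
  assumes "h \<in> A" "h + int p - int q \<in> A" "(p, q) \<noteq> (0, 0)"
  shows "card (walks A h (n + p + q) (Suc m) \<inter> heading p q)
    = card (walks A (h + int p - int q) n (Suc m)) + card (walks A (h + int p - int q) n m)"
proof -
  define h' where "h' = h + int p - int q"
  \<comment> \<open>the inverses of the two kinds of removal\<close>
  define grow where "grow = (\<lambda>w :: (nat \<times> nat) list. (fst (hd w) + p, snd (hd w) + q) # tl w)"
  define new where "new = (\<lambda>w :: (nat \<times> nat) list. (p, q) # w)"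
  have grow_Cons: "grow ((a, b) # w) = (a + p, b + q) # w" for a b w by (simp add: grow_def)
  have eq: "walks A h (n + p + q) (Suc m) \<inter> heading p q
      = grow ` walks A h' n (Suc m) \<union> new ` walks A h' n m" (is "?L = ?R")
  proof
    show "?L \<subseteq> ?R"
    proof
      fix w assume w: "w \<in> ?L"
      then obtain a b v where w_eq: "w = (a + p, b + q) # v"
        unfolding heading_def by (auto simp: le_iff_add add.commute)
      show "w \<in> ?R"
      proof (cases "(a, b) = (0, 0)")
        case True
        then have "v \<in> walks A h' n m" "w = new v"
          using w w_eq by (auto simp: walks_def h'_def new_def algebra_simps)
        then show ?thesis by blast
      next
        case False
        then have "(a, b) # v \<in> walks A h' n (Suc m)" "w = grow ((a, b) # v)"
          using w w_eq assms by (auto simp: walks_def h'_def grow_Cons algebra_simps)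
        then show ?thesis by blast
      qed
    qed
    have "grow w \<in> ?L" if "w \<in> walks A h' n (Suc m)" for w
    proof -
      obtain a b v where "w = (a, b) # v" using \<open>w \<in> _\<close>
        by (cases w) (auto simp: walks_def)
      then show ?thesis using that assms
        by (auto simp: walks_def h'_def grow_Cons heading_def algebra_simps)
    qed
    moreover have "new w \<in> ?L" if "w \<in> walks A h' n m" for w
      using that assms by (auto simp: walks_def h'_def new_def heading_def algebra_simps)
    ultimately show "?R \<subseteq> ?L" by blast
  qed
  have "grow w \<noteq> new v" if "w \<in> walks A h' n (Suc m)" for w v
    using that by (cases w) (auto simp: walks_def grow_def new_def)
  then have disj: "grow ` walks A h' n (Suc m) \<inter> new ` walks A h' n m = {}" by blast
  have inj: "inj_on grow (walks A h' n (Suc m))"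
  proof (rule inj_onI)
    fix w v assume "w \<in> walks A h' n (Suc m)" "v \<in> walks A h' n (Suc m)" "grow w = grow v"
    then show "w = v" by (cases w; cases v) (auto simp: walks_def grow_def prod_eq_iff)
  qed
  have inj': "inj_on new (walks A h' n m)" by (auto simp: inj_on_def new_def)
  show ?thesis
    unfolding eq h'_def[symmetric]
    by (simp add: card_Un_disjoint disj finite_walks card_image inj inj')
qed

lemma walks_0: "h \<in> A \<Longrightarrow> walks A h n 0 = {[]}"
  by (auto simp: walks_def)

lemma card_walks_0 [simp]: "h \<in> A \<Longrightarrow> card (walks A h n 0) = 1"
  by (simp add: walks_0)

text \<open>
  Every letter goes up or down, and inclusion and exclusion count the words whose first letter does both.
\<close>

lemma card_walks_Suc:
  "card (walks A h n (Suc m)) + card (walks A h n (Suc m) \<inter> heading 1 1)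
    = card (walks A h n (Suc m) \<inter> heading 1 0) + card (walks A h n (Suc m) \<inter> heading 0 1)"
proof -
  let ?W = "walks A h n (Suc m)"
  have "?W = (?W \<inter> heading 1 0) \<union> (?W \<inter> heading 0 1)" using heading_cover by blast
  moreover have "(?W \<inter> heading 1 0) \<inter> (?W \<inter> heading 0 1) = ?W \<inter> heading 1 1"
    using heading_Int[of 1 0 0 1] by auto
  ultimately show ?thesis
    using card_Un_Int[of "?W \<inter> heading 1 0" "?W \<inter> heading 0 1"] finite_walks by auto
qed

definition walk_series :: "int set \<Rightarrow> int \<Rightarrow> series2" where
  "walk_series A h = Abs_fps (\<lambda>n. Abs_fps (\<lambda>m. of_nat (card (walks A h n m))))"

lemma walk_series_nth [simp]:
  "fps_nth (fps_nth (walk_series A h) n) m = of_nat (card (walks A h n m))"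
  by (simp add: walk_series_def)

lemma series2_ext:
  fixes f g :: series2
  assumes "\<And>n m. fps_nth (fps_nth f n) m = fps_nth (fps_nth g n) m"
  shows "f = g"
  using assms by (simp add: fps_eq_iff)

lemma X_mult_nth [simp]: "fps_nth (X * f) n = (if n = 0 then 0 else fps_nth f (n - 1))"
  by (simp add: X_def)

lemma Y_mult_nth [simp]: "fps_nth (Y * f) n = fps_X * fps_nth f n"
  by (simp add: Y_def)

lemma XY_nth [simp]:
  "fps_nth X 0 = 0" "fps_nth X (Suc 0) = 1" "fps_nth Y 0 = fps_X" "fps_nth Y (Suc n) = 0"
  by (simp_all add: X_def Y_def)

lemma one_X_nth: "fps_nth (fps_nth (1 - X) n) m
    = (if m = 0 then if n = 0 then 1 else if n = 1 then -1 else 0 else 0)"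
  by (auto simp: X_def fps_X_def fps_one_def)

text \<open>
  The constants \<open>1 - X\<close> come from the empty words, to which the recurrence does not apply.
\<close>

lemma walk_series_interior:
  assumes "h - 1 \<in> A" "h \<in> A" "h + 1 \<in> A"
  shows "walk_series A h + X * (X * (walk_series A h + Y * walk_series A h))
    = 1 - X + X * (walk_series A (h + 1) + Y * walk_series A (h + 1)
                 + (walk_series A (h - 1) + Y * walk_series A (h - 1)))"
proof (rule series2_ext)
  fix n m
  note up = card_walks_heading[of h A 1 0, simplified] and down = card_walks_heading[of h A 0 1, simplified]
    and both = card_walks_heading[of h A 1 1, simplified]
  have [simp]: "walks A h 0 (Suc m) = {}" for m
    using heading_cover[of A h 0 m] walks_heading_empty[of 0 1 0 A h "Suc m"]
      walks_heading_empty[of 0 0 1 A h "Suc m"] by auto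
  note S = card_walks_Suc[of A h]
  show "fps_nth (fps_nth (walk_series A h + X * (X * (walk_series A h + Y * walk_series A h))) n) m
      = fps_nth (fps_nth (1 - X + X * (walk_series A (h + 1) + Y * walk_series A (h + 1)
                 + (walk_series A (h - 1) + Y * walk_series A (h - 1)))) n) m"
  proof (cases m)
    case 0
    consider "n = 0" | "n = 1" | k where "n = Suc (Suc k)" by (metis One_nat_def not0_implies_Suc)
    then show ?thesis using 0 assms one_X_nth[of n m] by cases (simp_all add: one_X_nth del: fps_sub_nth)
  next
    case (Suc l)
    consider "n = 0" | "n = 1" | k where "n = Suc (Suc k)" by (metis One_nat_def not0_implies_Suc)
    then show ?thesis
    proof cases
      case 1
      then show ?thesis using Suc by (simp add: one_X_nth del: fps_sub_nth)
    next
      case 2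
      have "walks A h 1 (Suc l) \<inter> heading 1 1 = {}" by (rule walks_heading_empty) simp
      then show ?thesis using 2 Suc S[of 1 l] up[of 0 l] down[of 0 l] assms
        by (simp add: one_X_nth flip: of_nat_add del: fps_sub_nth)
    next
      case 3
      have "card (walks A h (Suc (Suc k)) (Suc l)) + (card (walks A h k (Suc l)) + card (walks A h k l))
          = card (walks A (h + 1) (Suc k) (Suc l)) + card (walks A (h + 1) (Suc k) l)
            + (card (walks A (h - 1) (Suc k) (Suc l)) + card (walks A (h - 1) (Suc k) l))"
        using S[of "Suc (Suc k)" l, unfolded One_nat_def] up[OF assms(2,3), of "Suc k" l]
          down[OF assms(2,1), of "Suc k" l] both[OF assms(2), of k l] by linarith
      from arg_cong[OF this, of "of_nat :: nat \<Rightarrow> rat"] show ?thesis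
        using 3 Suc by (simp add: one_X_nth add_ac del: fps_sub_nth)
    qed
  qed
qed

text \<open>
  From height zero the first letter has to go up, so a single removal covers all nonempty words.
\<close>

lemma walk_series_boundary:
  "walk_series {0..} 0 = 1 + X * (walk_series {0..} 1 + Y * walk_series {0..} 1)"
proof (rule series2_ext)
  fix n m
  have eq: "walks {0..} 0 n (Suc l) = walks {0..} 0 n (Suc l) \<inter> heading 1 0" for n l
  proof -
    have "w \<in> heading 1 0" if w: "w \<in> walks {0..} 0 n (Suc l)" for w
    proof -
      obtain a b v where "w = (a, b) # v" using w by (cases w) (auto simp: walks_def)
      then show ?thesis using w by (cases v) (auto simp: walks_def heading_def)
    qed
    then show ?thesis by blast
  qed
  have [simp]: "walks {0..} 0 0 (Suc m) = {}" for m
    by (subst eq, rule walks_heading_empty) simp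
  have S: "card (walks {0..} 0 (Suc n) (Suc l)) = card (walks {0..} 1 n (Suc l)) + card (walks {0..} 1 n l)" for n l
    using card_walks_heading[of 0 "{0..}" 1 0 n l] by (subst eq) simp
  show "fps_nth (fps_nth (walk_series {0..} 0) n) m
      = fps_nth (fps_nth (1 + X * (walk_series {0..} 1 + Y * walk_series {0..} 1)) n) m"
    by (cases n; cases m) (simp_all add: S)
qed

text \<open>
  With heights zero every letter is \<open>(p, p)\<close>, so \<open>(1, 1)\<close> can always be removed.
\<close>

lemma walk_series_zero:
  "walk_series {0} 0 = 1 + X + X * (X * (walk_series {0} 0 + Y * walk_series {0} 0))"
proof (rule series2_ext)
  fix n m
  have eq: "walks {0} 0 n (Suc l) = walks {0} 0 n (Suc l) \<inter> heading 1 1" for n l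
  proof -
    have "w \<in> heading 1 1" if w: "w \<in> walks {0} 0 n (Suc l)" for w
    proof -
      obtain a b v where "w = (a, b) # v" using w by (cases w) (auto simp: walks_def)
      then show ?thesis using w by (cases v) (auto simp: walks_def heading_def)
    qed
    then show ?thesis by blast
  qed
  have e [simp]: "walks {0} 0 0 (Suc m) = {}" "walks {0} 0 (Suc 0) (Suc m) = {}" for m
    by (subst eq, rule walks_heading_empty, simp)+
  have S: "card (walks {0} 0 (Suc (Suc n)) (Suc l)) = card (walks {0} 0 n (Suc l)) + card (walks {0} 0 n l)" for n l
    using card_walks_heading[of 0 "{0}" 1 1 n l] by (subst eq) simp
  have oX: "fps_nth (fps_nth (1 + X) n) m = (if m = 0 \<and> n \<le> 1 then 1 else 0)" for n m
    by (auto simp: X_def fps_X_def fps_one_def)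
  consider "n = 0" | "n = 1" | k where "n = Suc (Suc k)" by (metis One_nat_def not0_implies_Suc)
  then show "fps_nth (fps_nth (walk_series {0} 0) n) m
      = fps_nth (fps_nth (1 + X + X * (X * (walk_series {0} 0 + Y * walk_series {0} 0))) n) m"
  proof cases
    case 1
    then show ?thesis by (cases m) (simp_all add: S del: fps_mult_nth_0)
  next
    case 2
    then show ?thesis by (cases m) (simp_all add: S del: fps_mult_nth_0 fps_mult_nth_1')
  next
    case (3 k)
    then show ?thesis using oX[of n m] by (cases m) (simp_all add: S del: fps_mult_nth_0)
  qed
qed

section \<open>The generating functions of words\<close>

lemma walks_UNIV: "walks UNIV h n m = walks UNIV 0 n m"
  by (simp add: walks_def stays_in_def)

abbreviation walks_free :: series2 where "walks_free \<equiv> walk_series UNIV 0"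

abbreviation walks_above :: "nat \<Rightarrow> series2" where "walks_above h \<equiv> walk_series {0..} (int h)"

text \<open>
  The weight of one unit step in the recurrences: \<open>X\<close> for the size, and \<open>1 + Y\<close> for the two ways in which the
  removal of a unit affects the length.
\<close>

definition unit_weight :: series2 where "unit_weight = X * (1 + Y)"

text \<open>
  The recurrence of \<open>walks_above\<close> multiplies a sequence that is constant in the height by this series;
  \<open>walks_free\<close> is its constant solution.
\<close>

definition tau :: series2 where "tau = 1 + X * unit_weight - 2 * unit_weight"

lemma series_nonzero: "X \<noteq> 0" "Y \<noteq> 0" "unit_weight \<noteq> 0" "tau \<noteq> 0"
proof -
  show x: "X \<noteq> 0" and "Y \<noteq> 0" by (simp_all add: X_def Y_def)
  have "fps_nth (fps_nth (1 + Y) 0) 0 = 1" "fps_nth (fps_nth tau 0) 0 = 1"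
    by (simp_all add: tau_def unit_weight_def)
  then have "1 + Y \<noteq> 0" "tau \<noteq> 0" by (metis fps_zero_nth zero_neq_one)+
  then show "unit_weight \<noteq> 0" "tau \<noteq> 0" using x by (auto simp: unit_weight_def)
qed

lemma walks_free_eq: "tau * walks_free = 1 - X"
proof -
  have *: "walk_series UNIV h = walks_free" for h
    by (simp add: walk_series_def walks_UNIV[of h])
  have "walks_free + X * (X * (walks_free + Y * walks_free))
      = 1 - X + X * (walks_free + Y * walks_free + (walks_free + Y * walks_free))"
    using walk_series_interior[of 0 UNIV] *[of 1] *[of "- 1"] by simp
  then show ?thesis unfolding tau_def unit_weight_def by algebra
qed

lemma walks_balanced_eq: "(1 - X * unit_weight) * walk_series {0} 0 = 1 + X"
  using walk_series_zero by (simp add: unit_weight_def algebra_simps)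

lemma walks_above_0: "walks_above 0 = 1 + unit_weight * walks_above 1"
  using walk_series_boundary by (simp add: unit_weight_def distrib_left distrib_right mult.assoc)

lemma walks_above_Suc:
  "(1 + X * unit_weight) * walks_above (Suc h) = 1 - X + unit_weight * (walks_above (Suc (Suc h)) + walks_above h)"
proof -
  have "int (Suc h) - 1 = int h" "int (Suc h) + 1 = int (Suc (Suc h))" by simp_all
  then show ?thesis
    using walk_series_interior[of "int (Suc h)" "{0..}"] unfolding unit_weight_def by simp algebra
qed

lemma height_ge: "- int (size_of w) \<le> height w"
proof (induction w)
  case (Cons a w)
  then show ?case by (cases a) auto
qed simp

lemma size_of_take: "size_of (take j w) \<le> size_of w"
proof (induction w arbitrary: j)
  case (Cons a w)
  then show ?case by (cases a; cases j) auto
qed simp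

text \<open>
  A word of size at most \<open>h\<close> cannot descend from \<open>h\<close> below zero.
\<close>

lemma walks_above_eq_free:
  assumes "n \<le> h"
  shows "fps_nth (walks_above h) n = fps_nth walks_free n"
proof -
  have "walks {0..} (int h) n m = walks UNIV 0 n m" for m
  proof -
    have "0 \<le> int h + height (take j w)" if "size_of w \<le> n" for j w
      using height_ge[of "take j w"] size_of_take[of j w] that assms by linarith
    then show ?thesis by (auto simp: walks_def stays_in_def)
  qed
  then show ?thesis by (simp add: fps_eq_iff)
qed

text \<open>
  The series of the words that do descend from \<open>h\<close> below zero.
\<close>

definition defect :: "nat \<Rightarrow> series2" where
  "defect h = walks_free - walks_above h"

lemma defect_rec: "(1 + X * unit_weight) * defect (Suc h) = unit_weight * (defect (Suc (Suc h)) + defect h)"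
proof -
  have free: "(1 + X * unit_weight) * walks_free = 1 - X + 2 * unit_weight * walks_free"
    using walks_free_eq by (simp add: tau_def algebra_simps)
  have "(1 + X * unit_weight) * defect (Suc h)
      = (1 - X + 2 * unit_weight * walks_free) - (1 - X + unit_weight * (walks_above (Suc (Suc h)) + walks_above h))"
    by (simp only: defect_def right_diff_distrib free walks_above_Suc)
  also have "\<dots> = unit_weight * (defect (Suc (Suc h)) + defect h)"
    unfolding defect_def by algebra
  finally show ?thesis .
qed

text \<open>
  The coefficients of the recurrence at \<open>h - 1\<close> and \<open>h + 1\<close> agree, therefore the two roots of its characteristic
  polynomial have product one and the quadratic expression \<open>I h\<close> in consecutive terms is invariant. Its value is zero as
  the defects tend to zero in the \<open>X\<close>-adic topology: only one of the roots contributes.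
\<close>

lemma defect_geometric: "defect 2 * defect 0 = (defect 1)\<^sup>2"
proof -
  define I where "I h = defect (Suc (Suc h)) * defect h - (defect (Suc h))\<^sup>2" for h
  have "unit_weight * I (Suc h) = unit_weight * I h" for h
  proof -
    have e1: "unit_weight * defect (Suc (Suc (Suc h))) = (1 + X * unit_weight) * defect (Suc (Suc h)) - unit_weight * defect (Suc h)"
      and e2: "unit_weight * defect h = (1 + X * unit_weight) * defect (Suc h) - unit_weight * defect (Suc (Suc h))"
      unfolding defect_rec by (simp_all add: distrib_left)
    have "unit_weight * I (Suc h) = (unit_weight * defect (Suc (Suc (Suc h)))) * defect (Suc h) - unit_weight * (defect (Suc (Suc h)))\<^sup>2"
      unfolding I_def by algebra
    also have "\<dots> = defect (Suc (Suc h)) * (unit_weight * defect h) - unit_weight * (defect (Suc h))\<^sup>2"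
      unfolding e1 e2 by algebra
    finally show ?thesis unfolding I_def by algebra
  qed
  then have "I (Suc h) = I h" for h using series_nonzero by simp
  then have I_const: "I h = I 0" for h by (induction h) auto
  have "fps_nth (I 0) n = 0" for n
  proof -
    have z: "fps_nth (defect h) i = 0" if "i \<le> h" for h i
      using walks_above_eq_free[OF that] by (simp add: defect_def)
    have "fps_nth (defect h * f) n = 0" if "n \<le> h" for h f
      unfolding fps_mult_nth using that by (intro sum.neutral) (simp add: z)
    then have "fps_nth (I n) n = 0"
      unfolding I_def power2_eq_square fps_sub_nth by simp
    then show ?thesis by (simp add: I_const[of n])
  qed
  then have "I 0 = 0" by (intro fps_ext) simp
  then show ?thesis unfolding I_def by (simp add: eval_nat_numeral)
qed

text \<open>
  Both \<open>defect 0\<close> and \<open>defect 1\<close> are affine functions of \<open>walks_above 0\<close>, by the formula for \<open>walks_free\<close> and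
  the boundary relation.
\<close>

lemma walks_above_quadratic: "tau * (walks_above 0 + unit_weight * (walks_above 0)\<^sup>2) = 1"
proof -
  define P where "P = walks_above 0"
  define d0 where "d0 = tau * defect 0"
  define d1 where "d1 = tau * (unit_weight * defect 1)"
  have d0: "d0 = 1 - X - tau * P"
    using walks_free_eq by (simp add: d0_def defect_def P_def algebra_simps)
  have "unit_weight * defect 1 = unit_weight * walks_free - (P - 1)"
    using walks_above_0 by (simp add: defect_def P_def algebra_simps)
  then have d1: "d1 = unit_weight * (1 - X) - tau * (P - 1)"
    unfolding d1_def walks_free_eq[symmetric] by algebra
  \<comment> \<open>the relation \<open>defect 2 * defect 0 = (defect 1)\<^sup>2\<close> with \<open>defect 2\<close> eliminated\<close>
  have "unit_weight * defect 2 = (1 + X * unit_weight) * defect 1 - unit_weight * defect 0"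
    unfolding defect_rec[of 0, folded One_nat_def] by (simp add: numeral_2_eq_2 distrib_left)
  then have "((1 + X * unit_weight) * (unit_weight * defect 1) - unit_weight\<^sup>2 * defect 0) * defect 0 = unit_weight\<^sup>2 * (defect 2 * defect 0)"
    by algebra
  then have "((1 + X * unit_weight) * d1 - unit_weight\<^sup>2 * d0) * d0 = d1\<^sup>2"
    unfolding defect_geometric d0_def d1_def by algebra
  \<comment> \<open>it contains the spurious factor \<open>X - unit_weight = - X Y\<close>\<close>
  moreover have "((1 + X * unit_weight) * d1 - unit_weight\<^sup>2 * d0) * d0 - d1\<^sup>2
      = (X - unit_weight) * (tau * (tau * (P + unit_weight * P\<^sup>2) - 1))"
    unfolding d0 d1 tau_def by algebra
  moreover have "X - unit_weight \<noteq> 0" using series_nonzero by (simp add: unit_weight_def algebra_simps)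
  ultimately show ?thesis using series_nonzero by (simp add: P_def)
qed

lemma alpha_eq: "alpha = (1 + X * unit_weight)\<^sup>2 - 4 * unit_weight\<^sup>2"
  by (simp add: alpha_def unit_weight_def algebra_simps power2_eq_square power4_eq_xxxx)

lemma sqrt_series_eqI:
  assumes "g\<^sup>2 = f" "fps_nth (fps_nth g 0) 0 = 1"
  shows "sqrt_series f = g"
  unfolding sqrt_series_def
proof (rule the_equality)
  fix g' assume g': "g'\<^sup>2 = f \<and> fps_nth (fps_nth g' 0) 0 = 1"
  then have "g' = g \<or> g' = - g" using assms by (metis power2_eq_iff)
  then show "g' = g" using g' assms by auto
qed (use assms in simp)

text \<open>
  By the quadratic equation \<open>(2 - \<tau> P)\<^sup>2 = \<alpha> P\<^sup>2\<close>. As \<open>P\<close> is invertible, \<open>(2 - \<tau> P) / P\<close> is a square root of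
  \<open>\<alpha>\<close>, and its constant term selects the right one.
\<close>

lemma walks_above_sqrt: "walks_above 0 * (tau + sqrt_series alpha) = 2"
proof -
  define P where "P = walks_above 0"
  have P0: "fps_nth (fps_nth P 0) 0 = 1" by (simp add: P_def)
  have "size_of w \<le> 0 \<Longrightarrow> (0, 0) \<notin> set w \<Longrightarrow> w = []" for w
    using length_le_size_of[of w] by simp
  then have "walks {0..} 0 0 m = (if m = 0 then {[]} else {})" for m
    by (auto simp: walks_def)
  then have "fps_nth P 0 = 1" by (simp add: P_def fps_eq_iff)
  then obtain Q where PQ: "P * Q = 1" using fps_right_inverse[of P 1] by auto
  have "sqrt_series alpha = (2 - tau * P) * Q"
  proof (rule sqrt_series_eqI)
    have "(2 - tau * P)\<^sup>2 - alpha * P\<^sup>2 = 4 * (1 - tau * (P + unit_weight * P\<^sup>2))"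
      by (simp add: alpha_eq tau_def algebra_simps power2_eq_square)
    then have "(2 - tau * P)\<^sup>2 = alpha * P\<^sup>2" using walks_above_quadratic by (simp add: P_def)
    then have "((2 - tau * P) * Q)\<^sup>2 = alpha * (P * Q)\<^sup>2" by (simp add: power_mult_distrib)
    then show "((2 - tau * P) * Q)\<^sup>2 = alpha" by (simp add: PQ)
    have "fps_nth (fps_nth (P * Q) 0) 0 = 1" unfolding PQ by simp
    then show "fps_nth (fps_nth ((2 - tau * P) * Q) 0) 0 = 1"
      using P0 by (simp add: tau_def unit_weight_def)
  qed
  then have "P * sqrt_series alpha = (2 - tau * P) * (P * Q)" by algebra
  then have "P * sqrt_series alpha = 2 - tau * P" by (simp add: PQ)
  then show ?thesis unfolding P_def[symmetric] distrib_left by (simp add: mult.commute)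
qed

section \<open>The generating function of faces\<close>

lemma walks_Int: "walks A h n m \<inter> walks B h n m = walks (A \<inter> B) h n m"
  by (auto simp: walks_def stays_in_def)

text \<open>
  Exchanging the entries of every letter changes the sign of all heights.
\<close>

lemma walks_swap: "card (walks {..0} 0 n m) = card (walks {0..} 0 n m)"
proof (rule bij_betw_same_card)
  have sw: "height (map prod.swap w) = - height w" "size_of (map prod.swap w) = size_of w"
    "(0, 0) \<in> set (map prod.swap w) \<longleftrightarrow> (0, 0) \<in> set w" for w
    by (induction w) (auto simp: height_def size_of_def)
  show "bij_betw (map prod.swap) (walks {..0} 0 n m) (walks {0..} 0 n m)"
    by (rule bij_betw_byWitness[of _ "map prod.swap"])
       (auto simp: walks_def stays_in_def sw(1) sw(2) take_map comp_def sw(3)[unfolded set_map])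
qed

lemma card_mixed_walks:
  "of_nat (card (mixed_walks n m)) = (of_nat (card (walks UNIV 0 n m))
    - 2 * of_nat (card (walks {0..} 0 n m)) + of_nat (card (walks {0} 0 n m)) :: rat)"
proof -
  have sub: "walks A 0 n m \<subseteq> walks UNIV 0 n m" for A by (auto simp: walks_def stays_in_def)
  have zero: "{0..} \<inter> {..0} = {0 :: int}" by auto
  have "card (walks {0..} 0 n m) + card (walks {..0} 0 n m)
      = card (walks {0..} 0 n m \<union> walks {..0} 0 n m) + card (walks {0} 0 n m)"
    using card_Un_Int[of "walks {0..} 0 n m" "walks {..0} 0 n m"]
    by (simp add: finite_walks walks_Int zero)
  moreover have "card (mixed_walks n m) + card (walks {0..} 0 n m \<union> walks {..0} 0 n m) = card (walks UNIV 0 n m)"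
    unfolding mixed_walks_def Diff_Diff_Int
    using card_Diff_subset[of "walks {0..} 0 n m \<union> walks {..0} 0 n m" "walks UNIV 0 n m"]
      card_mono[of "walks UNIV 0 n m" "walks {0..} 0 n m \<union> walks {..0} 0 n m"] sub
    by (simp add: finite_walks Diff_eq Int_assoc)
  ultimately have "card (mixed_walks n m) + 2 * card (walks {0..} 0 n m)
      = card (walks UNIV 0 n m) + card (walks {0} 0 n m)"
    by (simp add: walks_swap)
  from arg_cong[OF this, of "of_nat :: nat \<Rightarrow> rat"] show ?thesis by simp
qed

text \<open>
  The factor \<open>Y\<close> shifts the words with mixed signs, which are one letter longer than the dimension of their faces.
\<close>

lemma face_series_eq:
  "Y * face_series = walks_free - 2 * walks_above 0 + (1 + Y) * walk_series {0} 0"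
proof (rule series2_ext)
  fix n m
  have two: "fps_nth (fps_nth (2 * f) n) m = 2 * fps_nth (fps_nth f n) m" for f :: series2 and n m
    by (simp only: mult_2 fps_add_nth)
  show "fps_nth (fps_nth (Y * face_series) n) m
      = fps_nth (fps_nth (walks_free - 2 * walks_above 0 + (1 + Y) * walk_series {0} 0) n) m"
    by (cases m) (simp_all add: face_series_def num_faces_eq card_mixed_walks two distrib_right)
qed

lemma to_frac_hom:
  "to_frac (f * g) = to_frac f * to_frac g" "to_frac (f + g) = to_frac f + to_frac g"
  "to_frac (f - g) = to_frac f - to_frac g" "to_frac 1 = 1" "to_frac (numeral k) = numeral k"
  "to_frac f = 0 \<longleftrightarrow> f = 0"
proof -
  show "to_frac f = 0 \<longleftrightarrow> f = 0" by (simp add: to_frac_def Zero_fract_def eq_fract)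
  show one: "to_frac 1 = 1" by (simp add: to_frac_def One_fract_def)
  show add: "to_frac (f + g) = to_frac f + to_frac g" for f g by (simp add: to_frac_def)
  have "to_frac (of_nat n) = of_nat n" for n
    by (induction n) (simp_all add: add one, simp add: to_frac_def Zero_fract_def)
  from this[of "numeral k"] show "to_frac (numeral k) = numeral k" by simp
qed (simp_all add: to_frac_def)

theorem theorem3p1:
  shows "to_frac face_series =
    - (4 / to_frac (Y * (1 - 2*X + X^2 - 2*X*Y + X^2*Y + sqrt_series alpha)))
    + to_frac (2 - 2*X - 2*X^2 + 2*X^3 + Y - 3*X*Y - 3*X^2*Y + 3*X^3*Y
                 - 2*X*Y^2 - X^2*Y^2 + X^3*Y^2)
      / to_frac (Y * (1 - 2*X + 2*X^3 - X^4 - 2*X*Y + 4*X^3*Y - 2*X^4*Y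
                        + 2*X^3*Y^2 - X^4*Y^2))"
proof -
  define Z where "Z = walk_series {0} 0"
  define P where "P = walks_above 0"
  define T where "T = walks_free"
  define zeta where "zeta = 1 - X * unit_weight"
  define s where "s = tau + sqrt_series alpha"
  have s_eq: "1 - 2*X + X^2 - 2*X*Y + X^2*Y + sqrt_series alpha = s"
    by (simp add: s_def tau_def unit_weight_def algebra_simps power2_eq_square)
  have den: "1 - 2*X + 2*X^3 - X^4 - 2*X*Y + 4*X^3*Y - 2*X^4*Y + 2*X^3*Y^2 - X^4*Y^2 = tau * zeta"
    by (simp add: zeta_def tau_def unit_weight_def algebra_simps power2_eq_square power3_eq_cube power4_eq_xxxx)
  have "2 - 2*X - 2*X^2 + 2*X^3 + Y - 3*X*Y - 3*X^2*Y + 3*X^3*Y - 2*X*Y^2 - X^2*Y^2 + X^3*Y^2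
      = (1 - X) * zeta + (1 + Y) * (1 + X) * tau"
    by (simp add: zeta_def tau_def unit_weight_def algebra_simps power2_eq_square power3_eq_cube)
  also have "\<dots> = tau * zeta * (T + (1 + Y) * Z)"
  proof -
    have TZ: "1 - X = tau * T" "1 + X = zeta * Z"
      using walks_free_eq walks_balanced_eq by (simp_all add: zeta_def Z_def T_def)
    show ?thesis unfolding TZ by algebra
  qed
  finally have num: "2 - 2*X - 2*X^2 + 2*X^3 + Y - 3*X*Y - 3*X^2*Y + 3*X^3*Y - 2*X*Y^2 - X^2*Y^2 + X^3*Y^2
      = tau * zeta * (T + (1 + Y) * Z)" .
  have "fps_nth (fps_nth zeta 0) 0 = 1" by (simp add: zeta_def)
  then have "zeta \<noteq> 0" by auto
  have "P * s = 2" using walks_above_sqrt by (simp add: P_def s_def)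
  then have "s \<noteq> 0" by auto
  have Ps: "to_frac P * to_frac s = 2"
    using \<open>P * s = 2\<close> by (metis to_frac_hom(1,5))
  have nz: "to_frac s \<noteq> 0" "to_frac tau \<noteq> 0" "to_frac zeta \<noteq> 0" "to_frac Y \<noteq> 0"
    using \<open>s \<noteq> 0\<close> \<open>zeta \<noteq> 0\<close> series_nonzero by (simp_all add: to_frac_hom)
  have "4 / to_frac (Y * s) = 2 * to_frac P / to_frac Y"
  proof -
    have four: "4 = 2 * to_frac P * to_frac s" using Ps by (simp add: mult.assoc)
    show ?thesis unfolding to_frac_hom(1) four using nz by simp
  qed
  moreover have "to_frac (tau * zeta * (T + (1 + Y) * Z)) / to_frac (Y * (tau * zeta))
      = to_frac (T + (1 + Y) * Z) / to_frac Y"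
    using nz by (simp add: to_frac_hom(1))
  moreover have "to_frac face_series = to_frac (T - 2 * P + (1 + Y) * Z) / to_frac Y"
    using arg_cong[OF face_series_eq, of to_frac] nz
    by (simp add: to_frac_hom(1) field_simps T_def P_def Z_def)
  ultimately show ?thesis unfolding s_eq den num
    using nz by (simp add: to_frac_hom(2,3) add_divide_distrib diff_divide_distrib) (simp add: to_frac_hom)
qed

end
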